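(* If $A$ is a countable distance set, then ${\cong_A} \sim_B {\cong^\star_A}$.
   Context: $\mathbb{R}^+ = [0,\infty)$. A Polish metric space is a nonempty separable complete metric space. For a metric space $X$ let $D(X) = \{ d_X(x,y) \mid x,y \in X\}$. A set $A \subseteq \mathbb{R}^+$ is a distance set if $A = D(X)$ for some Polish metric space $X$. $\mathbb{U}$ is the Urysohn space, $F(\mathbb{U})$ the set of nonempty closed subsets of $\mathbb{U}$ with the Effros Borel structure; $\mathcal{V}_A = \{X \in F(\mathbb{U}) \mid D(X) \subseteq A\}$, $\mathcal{V}^\star_A = \{X \in F(\mathbb{U}) \mid D(X) = A\}$; $\cong_A$ and $\cong^\star_A$ are isometry restricted to $\mathcal{V}_A$ and $\mathcal{V}^\star_A$. $R \sim_B S$ means each is Borel reducible to the other, where $R \leq_B S$ means there is a Borel map $g$ with $x \mathrel{R} x' \iff g(x) \mathrel{S} g(x')$. *)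

theory Defs
  imports "HOL-Analysis.Analysis"
begin

section \<open>Isometries and Polish metric spaces\<close>

definition isometric_embedding :: "'a metric \<Rightarrow> 'b metric \<Rightarrow> ('a \<Rightarrow> 'b) \<Rightarrow> bool" where
  "isometric_embedding M N f \<longleftrightarrow>
     f ` mspace M \<subseteq> mspace N \<and>
     (\<forall>x\<in>mspace M. \<forall>y\<in>mspace M. mdist N (f x) (f y) = mdist M x y)"

definition isometry :: "'a metric \<Rightarrow> 'b metric \<Rightarrow> ('a \<Rightarrow> 'b) \<Rightarrow> bool" where
  "isometry M N f \<longleftrightarrow> isometric_embedding M N f \<and> f ` mspace M = mspace N"

definition isometric :: "'a metric \<Rightarrow> 'b metric \<Rightarrow> bool" where
  "isometric M N \<longleftrightarrow> (\<exists>f. isometry M N f)"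

definition Polish_metric :: "'a metric \<Rightarrow> bool" where
  "Polish_metric M \<longleftrightarrow>
     mspace M \<noteq> {} \<and> separable_space (mtopology_of M) \<and> mcomplete_of M"

definition dist_values :: "'a metric \<Rightarrow> real set" where
  "dist_values M = {mdist M x y | x y. x \<in> mspace M \<and> y \<in> mspace M}"

text \<open>
  A quantifier over all Polish metric spaces cannot range over all types inside a definition.
  It ranges here over the Polish metric spaces whose points are real numbers; since a Polish
  metric space has at most continuum many points, this loses nothing: see
  \<open>Polish_metric_real_copy\<close>, \<open>distance_set_dist_values\<close> and \<open>Urysohn_metric_universal\<close> below,
  which are stated for Polish metric spaces on an arbitrary type.
\<close>

definition distance_set :: "real set \<Rightarrow> bool" where
  "distance_set A \<longleftrightarrow> (\<exists>M :: real metric. Polish_metric M \<and> A = dist_values M)"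

section \<open>The Urysohn space\<close>

definition Polish_universal :: "'u metric \<Rightarrow> bool" where
  "Polish_universal U \<longleftrightarrow>
     (\<forall>M :: real metric. Polish_metric M \<longrightarrow> (\<exists>f. isometric_embedding M U f))"

definition ultrahomogeneous :: "'u metric \<Rightarrow> bool" where
  "ultrahomogeneous U \<longleftrightarrow>
     (\<forall>S f. finite S \<and> S \<subseteq> mspace U \<and> isometric_embedding (submetric U S) U f \<longrightarrow>
        (\<exists>g. isometry U U g \<and> (\<forall>x\<in>S. g x = f x)))"

text \<open>These properties determine the Urysohn space up to isometry.\<close>

definition Urysohn_metric :: "'u metric \<Rightarrow> bool" where
  "Urysohn_metric U \<longleftrightarrow> Polish_metric U \<and> Polish_universal U \<and> ultrahomogeneous U"

section \<open>The Effros Borel space and the classes of spaces with prescribed distances\<close>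

definition closed_nonempty :: "'u metric \<Rightarrow> 'u set set" where
  "closed_nonempty U = {X. closedin (mtopology_of U) X \<and> X \<noteq> {}}"

definition effros :: "'u metric \<Rightarrow> 'u set measure" where
  "effros U = sigma (closed_nonempty U)
     {{X \<in> closed_nonempty U. X \<inter> V \<noteq> {}} | V. openin (mtopology_of U) V}"

definition spaces_within :: "'u metric \<Rightarrow> real set \<Rightarrow> 'u set set" where
  "spaces_within U A = {X \<in> closed_nonempty U. dist_values (submetric U X) \<subseteq> A}"

definition spaces_exactly :: "'u metric \<Rightarrow> real set \<Rightarrow> 'u set set" where
  "spaces_exactly U A = {X \<in> closed_nonempty U. dist_values (submetric U X) = A}"

definition isometric_subspaces :: "'u metric \<Rightarrow> 'u set \<Rightarrow> 'u set \<Rightarrow> bool" where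
  "isometric_subspaces U X Y \<longleftrightarrow> isometric (submetric U X) (submetric U Y)"

section \<open>Borel reducibility\<close>

text \<open>
  A relation is given together with the measurable space on which it lives; for the relations
  below this is the relative Borel structure on the class in question.
\<close>

definition borel_reducible ::
  "'a measure \<Rightarrow> ('a \<Rightarrow> 'a \<Rightarrow> bool) \<Rightarrow> 'b measure \<Rightarrow> ('b \<Rightarrow> 'b \<Rightarrow> bool) \<Rightarrow> bool" where
  "borel_reducible M R N S \<longleftrightarrow>
     (\<exists>g \<in> M \<rightarrow>\<^sub>M N. \<forall>x\<in>space M. \<forall>x'\<in>space M. R x x' \<longleftrightarrow> S (g x) (g x'))"

definition borel_bireducible ::
  "'a measure \<Rightarrow> ('a \<Rightarrow> 'a \<Rightarrow> bool) \<Rightarrow> 'b measure \<Rightarrow> ('b \<Rightarrow> 'b \<Rightarrow> bool) \<Rightarrow> bool" where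
  "borel_bireducible M R N S \<longleftrightarrow> borel_reducible M R N S \<and> borel_reducible N S M R"

section \<open>Independence of the type carrying the points\<close>

lemma space_effros [simp]: "space (effros U) = closed_nonempty U"
  by (simp add: effros_def space_measure_of_conv)

lemma isometry_dist_values:
  assumes "isometry M N f"
  shows "dist_values N = dist_values M"
proof -
  have im: "mspace N = f ` mspace M"
    and d: "\<And>x y. x \<in> mspace M \<Longrightarrow> y \<in> mspace M \<Longrightarrow> mdist N (f x) (f y) = mdist M x y"
    using assms by (auto simp: isometry_def isometric_embedding_def)
  show ?thesis
    unfolding dist_values_def im using d by (safe; metis imageI)
qed

lemma isometry_Polish_metric:
  assumes f: "isometry M N f" and M: "Polish_metric M"
  shows "Polish_metric N"
proof -
  have im: "mspace N = f ` mspace M"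
    and d: "\<And>x y. x \<in> mspace M \<Longrightarrow> y \<in> mspace M \<Longrightarrow> mdist N (f x) (f y) = mdist M x y"
    using f by (auto simp: isometry_def isometric_embedding_def)
  interpret MN: Metric_space12 "mspace M" "mdist M" "mspace N" "mdist N"
    by (simp add: Metric_space12_def)
  have hom: "homeomorphic_map (mtopology_of M) (mtopology_of N) f"
    unfolding mtopology_of_def using MN.isometry_imp_homeomorphic_map im d by metis
  have "mcomplete_of N"
    unfolding mcomplete_of_def MN.M2.mcomplete_def
  proof (intro allI impI)
    fix s assume s: "MN.M2.MCauchy s"
    have "range s \<subseteq> f ` mspace M"
      using s unfolding MN.M2.MCauchy_def unfolding im by simp
    then have "\<forall>n. \<exists>x\<in>mspace M. s n = f x"
      by blast
    then obtain t where t: "\<And>n. t n \<in> mspace M" "\<And>n. s n = f (t n)"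
      by metis
    have "MN.M1.MCauchy t"
      using s t d unfolding MN.M1.MCauchy_def MN.M2.MCauchy_def by auto
    then obtain x where x: "limitin MN.M1.mtopology t x sequentially"
      using M unfolding Polish_metric_def mcomplete_of_def MN.M1.mcomplete_def by blast
    then have "limitin MN.M2.mtopology (f \<circ> t) (f x) sequentially"
      using continuous_map_limit[OF homeomorphic_imp_continuous_map[OF hom]]
      by (simp add: mtopology_of_def)
    moreover have "f \<circ> t = s" using t(2) by (simp add: fun_eq_iff)
    ultimately show "\<exists>y. limitin MN.M2.mtopology s y sequentially" by auto
  qed
  moreover have "separable_space (mtopology_of N)"
    using M hom homeomorphic_separable_space homeomorphic_map_imp_homeomorphic_space
    unfolding Polish_metric_def by blast
  ultimately show ?thesis
    using M im by (auto simp: Polish_metric_def)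
qed

lemma Polish_metric_real_copy:
  fixes M :: "'a metric"
  assumes M: "Polish_metric M"
  shows "\<exists>N :: real metric. Polish_metric N \<and> isometric M N"
proof -
  interpret M: Metric_space "mspace M" "mdist M" by simp
  obtain C where C: "countable C" "C \<subseteq> mspace M" "M.mtopology closure_of C = mspace M"
    using M unfolding Polish_metric_def separable_space_def
    by (auto simp: mtopology_of_def)
  define k where "k x = {p. \<exists>c\<in>C. \<exists>q::rat. p = to_nat (to_nat_on C c, q) \<and> mdist M x c < of_rat q}"
    for x
  have k: "inj_on k (mspace M)"
  proof (rule inj_onI, rule ccontr)
    fix x y assume x: "x \<in> mspace M" and y: "y \<in> mspace M" and eq: "k x = k y" and ne: "x \<noteq> y"
    let ?e = "mdist M x y"
    have e: "?e > 0" using x y ne by (simp add: M.mdist_pos_less)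
    then have "x \<in> M.mtopology closure_of C" using C x by simp
    then have "\<forall>r>0. \<exists>c\<in>C. c \<in> M.mball x r"
      unfolding M.metric_closure_of by simp
    then obtain c where c: "c \<in> C" "c \<in> M.mball x (?e / 2)"
      using half_gt_zero[OF e] by blast
    then have lt: "mdist M x c < ?e / 2" by auto
    then obtain q where q: "mdist M x c < of_rat q" "of_rat q < ?e / 2"
      using of_rat_dense by blast
    then have "to_nat (to_nat_on C c, q) \<in> k x"
      unfolding k_def using c by blast
    then have "to_nat (to_nat_on C c, q) \<in> k y"
      using eq by simp
    then have "mdist M y c < of_rat q"
      using C c inj_on_to_nat_on[OF C(1)] by (auto simp: k_def inj_on_eq_iff)
    moreover have "?e \<le> mdist M x c + mdist M c y"
      using x y c C by (auto intro: M.triangle)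
    ultimately show False using q M.commute[of c y] by linarith
  qed
  obtain b :: "nat set \<Rightarrow> real" where "bij b"
    using nat_sets_eqpoll_reals unfolding eqpoll_def by blast
  define h where "h = b \<circ> k"
  have h: "inj_on h (mspace M)"
    using k \<open>bij b\<close> unfolding h_def by (meson bij_is_inj comp_inj_on inj_on_subset subset_UNIV)
  define g where "g = inv_into (mspace M) h"
  have g [simp]: "g (h x) = x" if "x \<in> mspace M" for x
    using h that by (simp add: g_def)
  have "Metric_space (h ` mspace M) (\<lambda>u v. mdist M (g u) (g v))"
    by (unfold_locales; auto simp: M.commute M.triangle)
  then interpret N: Metric_space "h ` mspace M" "\<lambda>u v. mdist M (g u) (g v)" .
  have "isometry M N.Self h"
    by (auto simp: isometry_def isometric_embedding_def)
  then show ?thesis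
    using M isometry_Polish_metric unfolding isometric_def by blast
qed

lemma distance_set_dist_values:
  fixes M :: "'a metric"
  assumes "Polish_metric M"
  shows "distance_set (dist_values M)"
  using Polish_metric_real_copy[OF assms] isometry_dist_values
  unfolding distance_set_def isometric_def by metis

lemma Urysohn_metric_universal:
  fixes U :: "'u metric" and M :: "'a metric"
  assumes U: "Urysohn_metric U" and M: "Polish_metric M"
  shows "\<exists>f. isometric_embedding M U f"
proof -
  obtain N :: "real metric" and h where N: "Polish_metric N" and h: "isometry M N h"
    using Polish_metric_real_copy[OF M] unfolding isometric_def by blast
  obtain f where "isometric_embedding N U f"
    using U N unfolding Urysohn_metric_def Polish_universal_def by blast
  then have "isometric_embedding M U (f \<circ> h)"
    using h by (simp add: isometry_def isometric_embedding_def image_subset_iff flip: image_comp)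
  then show ?thesis by blast
qed

end

theory Submission
  imports Defs "HOL-Library.Equipollence"
begin

text \<open>
  To a space \<open>X\<close> with distances in \<open>A\<close> we attach, for every \<open>a \<in> A\<close>, a layer \<open>X \<times> {a}\<close>. Two points
  \<open>(x, a)\<close> and \<open>(y, b)\<close> have distance \<open>max (d x y) (max a b)\<close>, except that inside a layer \<open>a > 0\<close> the
  term \<open>a\<close> is dropped when \<open>x\<close> and \<open>y\<close> have the same closed ball of radius \<open>s a\<close>. If the distances of
  \<open>X\<close> avoid an interval just above \<open>s a\<close>, this equivalence relation is open, so the new space is
  Polish. If moreover some positive \<open>b < a\<close> in \<open>A\<close> is not a distance of \<open>X\<close> up to \<open>s a\<close>, then points
  of layer \<open>a\<close> never realize \<open>b\<close>. Points of layer \<open>0\<close> realize all of \<open>A\<close>, so \<open>X\<close> can be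
  recovered: the points realizing all distances form \<open>X\<close>, or two copies of \<open>X\<close> if \<open>A - {0}\<close> has a
  least element.

  Suitable gaps exist when \<open>A\<close> is not dense in any interval \<open>(0, r)\<close>. When it is, \<open>X\<close> is first
  rescaled by an injective subadditive \<open>f\<close> from \<open>A\<close> to a bounded part of \<open>A\<close> omitting a null
  sequence of elements of \<open>A\<close>; then \<open>s\<close> can be taken constant.

  Since \<open>A\<close> is countable, a dense sequence of the new space is placed in the Urysohn space one point
  at a time by arbitrary choices that depend only on finitely many distances, hence take countably
  many values and are Borel.
\<close>

section \<open>Polish metric spaces\<close>

lemma mcomplete_of_alt:
  fixes M :: "'a metric"
  shows "mcomplete_of M \<longleftrightarrow>
     (\<forall>s :: nat \<Rightarrow> 'a. (\<forall>n. s n \<in> mspace M) \<longrightarrow>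
          (\<forall>\<epsilon>>0. \<exists>N. \<forall>n\<ge>N. \<forall>k\<ge>N. mdist M (s n) (s k) < \<epsilon>) \<longrightarrow>
          (\<exists>x\<in>mspace M. \<forall>\<epsilon>>0. \<exists>N. \<forall>n\<ge>N. mdist M (s n) x < \<epsilon>))"
proof -
  interpret Metric_space "mspace M" "mdist M" by simp
  have "(\<forall>n. s n \<in> mspace M) \<Longrightarrow>
      (\<exists>x. limitin mtopology s x sequentially) \<longleftrightarrow>
      (\<exists>x\<in>mspace M. \<forall>\<epsilon>>0. \<exists>N. \<forall>n\<ge>N. mdist M (s n) x < \<epsilon>)" for s
    unfolding limitin_metric eventually_sequentially by auto
  moreover have "MCauchy s \<longleftrightarrow> (\<forall>n. s n \<in> mspace M) \<and>
      (\<forall>\<epsilon>>0. \<exists>N. \<forall>n\<ge>N. \<forall>k\<ge>N. mdist M (s n) (s k) < \<epsilon>)" for s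
    unfolding MCauchy_def image_subset_iff by simp
  ultimately show ?thesis
    unfolding mcomplete_of_def mcomplete_def by (simp cong: imp_cong add: imp_conjL)
qed

lemma mdist_self: "x \<in> mspace M \<Longrightarrow> mdist M x x = 0"
  by simp

lemma mcomplete_ofD:
  fixes s :: "nat \<Rightarrow> 'a"
  assumes "mcomplete_of M" "\<And>n. s n \<in> mspace M"
    and "\<forall>\<epsilon>>0. \<exists>N. \<forall>n\<ge>N. \<forall>k\<ge>N. mdist M (s n) (s k) < \<epsilon>"
  shows "\<exists>x\<in>mspace M. \<forall>\<epsilon>>0. \<exists>N. \<forall>n\<ge>N. mdist M (s n) x < \<epsilon>"
  using assms unfolding mcomplete_of_alt by simp

text \<open>Density with an indexing, repetitions allowed: Borel dependence on a space can then be
  expressed through the countably many numbers \<open>mdist M (e i) (e j)\<close>.\<close>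

definition dense_seq :: "'a metric \<Rightarrow> (nat \<Rightarrow> 'a) \<Rightarrow> bool" where
  "dense_seq M e \<longleftrightarrow>
     (\<forall>i. e i \<in> mspace M) \<and> (\<forall>x\<in>mspace M. \<forall>\<epsilon>>0. \<exists>i. mdist M x (e i) < \<epsilon>)"

lemma dense_seq_in: "dense_seq M e \<Longrightarrow> e i \<in> mspace M"
  by (simp add: dense_seq_def)

lemma dense_seq_near:
  "dense_seq M e \<Longrightarrow> x \<in> mspace M \<Longrightarrow> \<epsilon> > 0 \<Longrightarrow> \<exists>i. mdist M x (e i) < \<epsilon>"
  by (simp add: dense_seq_def)

lemma separable_of_dense_seq:
  assumes "dense_seq M e"
  shows "separable_space (mtopology_of M)"
proof -
  interpret Metric_space "mspace M" "mdist M" by simp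
  have "mtopology closure_of (range e) = mspace M"
    unfolding metric_closure_of using assms by (auto simp: dense_seq_def)
  then show ?thesis
    unfolding separable_space_def mtopology_of_def
    using assms by (intro exI[of _ "range e"]) (auto simp: dense_seq_def)
qed

lemma Polish_metric_dense_seq:
  assumes "Polish_metric M"
  obtains e where "dense_seq M e"
proof -
  interpret Metric_space "mspace M" "mdist M" by simp
  obtain C where C: "countable C" "C \<subseteq> mspace M" "mtopology closure_of C = mspace M"
    using assms unfolding Polish_metric_def separable_space_def by (auto simp: mtopology_of_def)
  have "C \<noteq> {}"
    using C(3) assms unfolding Polish_metric_def by auto
  then have r: "range (from_nat_into C) = C"
    by (rule range_from_nat_into[OF _ C(1)])
  have "\<forall>x\<in>mspace M. \<forall>\<epsilon>>0. \<exists>i. mdist M x (from_nat_into C i) < \<epsilon>"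
  proof (intro ballI allI impI)
    fix x and \<epsilon> :: real assume x: "x \<in> mspace M" and \<epsilon>: "\<epsilon> > 0"
    then have "x \<in> mtopology closure_of C"
      using C(3) by simp
    then obtain y where "y \<in> C" "mdist M x y < \<epsilon>"
      using \<epsilon> unfolding metric_closure_of by auto
    then show "\<exists>i. mdist M x (from_nat_into C i) < \<epsilon>"
      using r by (metis imageE)
  qed
  moreover have "\<forall>i. from_nat_into C i \<in> mspace M"
    using r C(2) by blast
  ultimately show thesis
    using that unfolding dense_seq_def by blast
qed

lemma dist_values_nonneg: "t \<in> dist_values M \<Longrightarrow> t \<ge> 0"
  by (auto simp: dist_values_def)

lemma zero_in_dist_values: "mspace M \<noteq> {} \<Longrightarrow> 0 \<in> dist_values M"
proof -
  assume "mspace M \<noteq> {}"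
  then obtain x where x: "x \<in> mspace M"
    by blast
  then have "mdist M x x = 0"
    by simp
  with x show ?thesis
    unfolding dist_values_def by (metis (mono_tags, lifting) mem_Collect_eq)
qed

lemma mdist_in_dist_values:
  "x \<in> mspace M \<Longrightarrow> y \<in> mspace M \<Longrightarrow> mdist M x y \<in> dist_values M"
  by (auto simp: dist_values_def)

lemma Polish_submetric:
  assumes U: "Polish_metric U" and X: "X \<in> closed_nonempty U" and e: "dense_seq (submetric U X) e"
  shows "Polish_metric (submetric U X)"
proof -
  have cl: "closedin (mtopology_of U) X" and ne: "X \<noteq> {}"
    using X by (auto simp: closed_nonempty_def)
  have sub: "X \<subseteq> mspace U"
    using closedin_subset[OF cl] by simp
  interpret S: Submetric "mspace U" "mdist U" X
    by (simp add: Submetric_def Submetric_axioms_def sub)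
  have "S.sub.mcomplete"
    using U cl S.closedin_mcomplete_imp_mcomplete
    by (simp add: Polish_metric_def mcomplete_of_def mtopology_of_def)
  then have "mcomplete_of (submetric U X)"
    using sub by (simp add: mcomplete_of_def Int_absorb2)
  then show ?thesis
    using ne sub separable_of_dense_seq[OF e] by (auto simp: Polish_metric_def)
qed

section \<open>Isometries, and isometry from matching dense sequences\<close>

lemma isometryI:
  assumes "\<And>x. x \<in> mspace M \<Longrightarrow> f x \<in> mspace N"
    and "\<And>y. y \<in> mspace N \<Longrightarrow> \<exists>x\<in>mspace M. f x = y"
    and "\<And>x y. x \<in> mspace M \<Longrightarrow> y \<in> mspace M \<Longrightarrow> mdist N (f x) (f y) = mdist M x y"
  shows "isometry M N f"
  using assms unfolding isometry_def isometric_embedding_def by auto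

lemma isometryD:
  assumes "isometry M N f"
  shows "x \<in> mspace M \<Longrightarrow> f x \<in> mspace N"
    and "y \<in> mspace N \<Longrightarrow> \<exists>x\<in>mspace M. f x = y"
    and "x \<in> mspace M \<Longrightarrow> z \<in> mspace M \<Longrightarrow> mdist N (f x) (f z) = mdist M x z"
  using assms unfolding isometry_def isometric_embedding_def by (blast, metis imageE, blast)

lemma isometry_bij_betw: "isometry M N f \<Longrightarrow> bij_betw f (mspace M) (mspace N)"
  unfolding bij_betw_def isometry_def isometric_embedding_def inj_on_def by (metis mdist_zero)

lemma isometric_sym: "isometric M N \<Longrightarrow> isometric N M"
proof -
  assume "isometric M N"
  then obtain f where f: "isometry M N f"
    by (auto simp: isometric_def)
  note b = isometry_bij_betw[OF f]
  have inv: "inv_into (mspace M) f y \<in> mspace M" "f (inv_into (mspace M) f y) = y"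
    if "y \<in> mspace N" for y
    using that b by (auto simp: bij_betw_def inv_into_into f_inv_into_f)
  have "isometry N M (inv_into (mspace M) f)"
  proof (rule isometryI)
    show "inv_into (mspace M) f y \<in> mspace M" if "y \<in> mspace N" for y
      using inv(1)[OF that] .
    show "\<exists>y\<in>mspace N. inv_into (mspace M) f y = x" if "x \<in> mspace M" for x
      using that b by (metis bij_betw_inv_into_left isometryD(1)[OF f])
    show "mdist M (inv_into (mspace M) f x) (inv_into (mspace M) f y) = mdist N x y"
      if "x \<in> mspace N" "y \<in> mspace N" for x y
      using isometryD(3)[OF f inv(1)[OF that(1)] inv(1)[OF that(2)]] inv(2)[OF that(1)] inv(2)[OF that(2)]
      by simp
  qed
  then show ?thesis
    by (auto simp: isometric_def)
qed

lemma isometric_trans: "isometric M N \<Longrightarrow> isometric N P \<Longrightarrow> isometric M P"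
proof -
  assume "isometric M N" "isometric N P"
  then obtain f g where f: "isometry M N f" and g: "isometry N P g"
    by (auto simp: isometric_def)
  have "isometry M P (g \<circ> f)"
    by (rule isometryI) (auto simp: isometryD[OF f] isometryD[OF g], metis isometryD(2)[OF f] isometryD(2)[OF g])
  then show ?thesis
    by (auto simp: isometric_def)
qed

text \<open>Choose indices \<open>k n\<close> with \<open>e (k n)\<close> tending to
  \<open>x\<close>. Equality of distances makes \<open>h (k n)\<close> Cauchy, and its limit is
  \<open>y\<close>. One index \<open>i\<close> approximates \<open>x\<close> and \<open>y\<close>
  simultaneously, as the graph of an isometry needs.\<close>

lemma complete_transfer_point:
  assumes N: "mcomplete_of N" and e: "\<And>i. e i \<in> mspace M" and h: "\<And>i. h i \<in> mspace N"
    and eq: "\<And>i j. mdist N (h i) (h j) = mdist M (e i) (e j)"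
    and x: "x \<in> mspace M" and near: "\<And>\<epsilon>. \<epsilon> > 0 \<Longrightarrow> \<exists>i. mdist M x (e i) < \<epsilon>"
  shows "\<exists>y\<in>mspace N. \<forall>\<epsilon>>0. \<exists>i. mdist M x (e i) < \<epsilon> \<and> mdist N y (h i) < \<epsilon>"
proof -
  have "\<forall>n. \<exists>i. mdist M x (e i) < inverse (real (Suc n))"
    using near by simp
  then obtain k where k: "\<And>n. mdist M x (e (k n)) < inverse (real (Suc n))"
    by metis
  have k': "\<exists>N. \<forall>n\<ge>N. mdist M x (e (k n)) < \<epsilon>" if \<epsilon>: "\<epsilon> > 0" for \<epsilon>
  proof -
    obtain N where N: "inverse (real (Suc N)) < \<epsilon>"
      using reals_Archimedean[OF \<epsilon>] by blast
    have "mdist M x (e (k n)) < \<epsilon>" if "n \<ge> N" for n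
    proof -
      have "inverse (real (Suc n)) \<le> inverse (real (Suc N))"
        using that by (intro le_imp_inverse_le) auto
      then show ?thesis
        using k[of n] N by linarith
    qed
    then show ?thesis by blast
  qed
  have "\<forall>\<epsilon>>0. \<exists>K. \<forall>n\<ge>K. \<forall>m\<ge>K. mdist N (h (k n)) (h (k m)) < \<epsilon>"
  proof (intro allI impI)
    fix \<epsilon> :: real assume "\<epsilon> > 0"
    then obtain K where K: "\<forall>n\<ge>K. mdist M x (e (k n)) < \<epsilon> / 2"
      using k'[of "\<epsilon> / 2"] by auto
    have "mdist M (e (k n)) (e (k m)) < \<epsilon>" if "n \<ge> K" "m \<ge> K" for n m
    proof -
      have "mdist M x (e (k n)) < \<epsilon> / 2" "mdist M x (e (k m)) < \<epsilon> / 2"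
        using K that by auto
      then show ?thesis
        using mdist_triangle[OF e x e, of "k n" "k m"] mdist_commute[of M x "e (k n)"] by linarith
    qed
    then show "\<exists>N'. \<forall>n\<ge>N'. \<forall>m\<ge>N'. mdist N (h (k n)) (h (k m)) < \<epsilon>"
      using eq by auto
  qed
  then obtain y where y: "y \<in> mspace N" and lim: "\<And>\<epsilon>. \<epsilon> > 0 \<Longrightarrow> \<exists>K. \<forall>n\<ge>K. mdist N (h (k n)) y < \<epsilon>"
    using mcomplete_ofD[OF N, of "\<lambda>n. h (k n)"] h by blast
  have "\<exists>i. mdist M x (e i) < \<epsilon> \<and> mdist N y (h i) < \<epsilon>" if \<epsilon>: "\<epsilon> > 0" for \<epsilon>
  proof -
    obtain K L where "\<forall>n\<ge>K. mdist M x (e (k n)) < \<epsilon>" "\<forall>n\<ge>L. mdist N (h (k n)) y < \<epsilon>"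
      using k'[OF \<epsilon>] lim[OF \<epsilon>] by blast
    then have "mdist M x (e (k (max K L))) < \<epsilon>" "mdist N (h (k (max K L))) y < \<epsilon>"
      by auto
    then show ?thesis
      by (metis mdist_commute)
  qed
  then show ?thesis
    using y by blast
qed

lemma isometric_of_dense_seqs:
  assumes M: "mcomplete_of M" and N: "mcomplete_of N" and e: "dense_seq M e" and h: "dense_seq N h"
    and eq: "\<And>i j. mdist N (h i) (h j) = mdist M (e i) (e j)"
  shows "isometric M N"
proof -
  \<comment> \<open>\<open>R\<close> is the graph of the isometry: common approximation by points of
    equal index. Completeness makes it total in both directions, and distances agree because they
    are approximated by the equal distances along \<open>e\<close> and \<open>h\<close>.\<close>
  define R where "R x y \<longleftrightarrow> (\<forall>\<epsilon>>0. \<exists>i. mdist M x (e i) < \<epsilon> \<and> mdist N y (h i) < \<epsilon>)" for x y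
  have ex1: "\<exists>y\<in>mspace N. R x y" if "x \<in> mspace M" for x
    unfolding R_def
    using complete_transfer_point[OF N dense_seq_in[OF e] dense_seq_in[OF h] eq that
        dense_seq_near[OF e that]] .
  have ex2: "\<exists>x\<in>mspace M. R x y" if "y \<in> mspace N" for y
    unfolding R_def
    using complete_transfer_point[OF M dense_seq_in[OF h] dense_seq_in[OF e] eq[symmetric] that
        dense_seq_near[OF h that]] by meson
  have iso: "mdist M x x' = mdist N y y'"
    if x: "x \<in> mspace M" "x' \<in> mspace M" and y: "y \<in> mspace N" "y' \<in> mspace N"
      and R: "R x y" "R x' y'" for x x' y y'
  proof -
    have "\<bar>mdist M x x' - mdist N y y'\<bar> \<le> \<epsilon>" if "\<epsilon> > 0" for \<epsilon>
    proof -
      obtain i j where i: "mdist M x (e i) < \<epsilon> / 4" "mdist N y (h i) < \<epsilon> / 4"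
        and j: "mdist M x' (e j) < \<epsilon> / 4" "mdist N y' (h j) < \<epsilon> / 4"
        using R \<open>\<epsilon> > 0\<close> unfolding R_def by (meson divide_pos_pos zero_less_numeral)
      interpret M: Metric_space "mspace M" "mdist M" by simp
      interpret N: Metric_space "mspace N" "mdist N" by simp
      note ei = dense_seq_in[OF e, of i] and ej = dense_seq_in[OF e, of j]
        and hi = dense_seq_in[OF h, of i] and hj = dense_seq_in[OF h, of j]
      have "\<bar>mdist M x x' - mdist M (e i) (e j)\<bar> < \<epsilon> / 2"
        using M.mdist_reverse_triangle[OF x(1) x(2) ei] M.mdist_reverse_triangle[OF x(2) ei ej]
          M.commute[of "e i" x'] i j by linarith
      moreover have "\<bar>mdist N y y' - mdist N (h i) (h j)\<bar> < \<epsilon> / 2"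
        using N.mdist_reverse_triangle[OF y(1) y(2) hi] N.mdist_reverse_triangle[OF y(2) hi hj]
          N.commute[of "h i" y'] i j by linarith
      ultimately show ?thesis
        using eq[of i j] by linarith
    qed
    then show ?thesis
      using field_le_epsilon[of "\<bar>mdist M x x' - mdist N y y'\<bar>" 0] by simp
  qed
  obtain f where f: "\<And>x. x \<in> mspace M \<Longrightarrow> f x \<in> mspace N \<and> R x (f x)"
    using ex1 by metis
  have "isometry M N f"
  proof (rule isometryI)
    fix y assume y: "y \<in> mspace N"
    then obtain x where x: "x \<in> mspace M" "R x y"
      using ex2 by blast
    then have "mdist N (f x) y = 0"
      using iso[OF x(1) x(1) _ y _ x(2), of "f x"] f[OF x(1)] mdist_zero[OF x(1) x(1)] by metis
    then show "\<exists>x\<in>mspace M. f x = y"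
      using x f y by auto
  qed (use f in blast, use f iso in metis)
  then show ?thesis
    by (auto simp: isometric_def)
qed

section \<open>Cancelling a finite factor from a bijection\<close>

lemma infinite_times_finite_eqpoll:
  assumes "infinite A" and K: "finite K" "K \<noteq> {}"
  shows "A \<times> K \<approx> A"
proof -
  have "K \<lesssim> A"
    using assms by (simp add: finite_lepoll_infinite)
  then show ?thesis
    using card_of_Times_infinite[OF assms(1) K(2)]
    by (simp add: eqpoll_iff_card_of_ordIso lepoll_def card_of_ordLeq)
qed

text \<open>Finite sets are compared by counting; infinite ones absorb the factor
  \<open>K\<close>.\<close>

lemma eqpoll_times_finite_cancel:
  assumes AB: "A \<times> K \<approx> B \<times> K" and K: "finite K" "K \<noteq> {}"
  shows "A \<approx> B"
proof (cases "finite A")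
  case True
  then have fin: "finite B"
    using eqpoll_finite_iff[OF AB] K by (auto simp: finite_cartesian_product_iff)
  then have "card (A \<times> K) = card (B \<times> K)"
    using AB True K eqpoll_iff_card[of "A \<times> K" "B \<times> K"] by simp
  then show ?thesis
    using True fin K by (simp add: card_cartesian_product eqpoll_iff_card)
next
  case False
  then have "infinite B"
    using eqpoll_finite_iff[OF AB] K by (auto simp: finite_cartesian_product_iff)
  then show ?thesis
    using AB infinite_times_finite_eqpoll[OF False K] infinite_times_finite_eqpoll[OF _ K, of B]
    by (meson eqpoll_sym eqpoll_trans)
qed

text \<open>Points with the same distances to everything form classes, and an isometry carries classes
  to classes, each counted \<open>card K\<close> times.\<close>

lemma bij_of_multiple_copies:
  fixes D1 :: "'a \<Rightarrow> 'a \<Rightarrow> 'c" and D2 :: "'b \<Rightarrow> 'b \<Rightarrow> 'c"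
  assumes K: "finite K" "k \<in> K" and F: "bij_betw F (X \<times> K) (Y \<times> K)"
    and pres: "\<And>p q. p \<in> X \<times> K \<Longrightarrow> q \<in> X \<times> K \<Longrightarrow> D2 (fst (F p)) (fst (F q)) = D1 (fst p) (fst q)"
    and sym: "\<And>y y'. y \<in> Y \<Longrightarrow> y' \<in> Y \<Longrightarrow> D2 y y' = D2 y' y"
  shows "\<exists>h. bij_betw h X Y \<and> (\<forall>x\<in>X. \<forall>x'\<in>X. D2 (h x) (h x') = D1 x x')"
proof -
  define C1 where "C1 x = {x'\<in>X. \<forall>z\<in>X. D1 x' z = D1 x z}" for x
  define C2 where "C2 y = {y'\<in>Y. \<forall>z\<in>Y. D2 y' z = D2 y z}" for y
  \<comment> \<open>\<open>F\<close> need not act on first coordinates. The point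
    \<open>p x\<close>, read off from the copy of index \<open>k\<close>, only names the class in
    \<open>Y\<close> that corresponds to the class of \<open>x\<close>.\<close>
  define p where "p x = fst (F (x, k))" for x
  have FX: "F q \<in> Y \<times> K" if "q \<in> X \<times> K" for q
    using F that by (meson bij_betwE)
  have FY: "\<exists>q\<in>X \<times> K. F q = r" if "r \<in> Y \<times> K" for r
    using F that by (metis bij_betw_imp_surj_on imageE)
  have pX: "p x \<in> Y" if "x \<in> X" for x
    using FX[of "(x, k)"] that K by (auto simp: p_def mem_Times_iff)
  \<comment> \<open>Distances to all of \<open>X\<close> are distances to all its copies, so
    \<open>F\<close> carries the class of \<open>x\<close>, with all copies, exactly onto that of
    \<open>p x\<close>.\<close>
  have iff: "fst (F q) \<in> C2 (p x) \<longleftrightarrow> fst q \<in> C1 x" if q: "q \<in> X \<times> K" and x: "x \<in> X" for q x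
  proof
    have xk: "(x, k) \<in> X \<times> K"
      using x K by simp
    {
      assume L: "fst (F q) \<in> C2 (p x)"
      have "D1 (fst q) z = D1 x z" if z: "z \<in> X" for z
      proof -
        have zk: "(z, k) \<in> X \<times> K"
          using z K by simp
        have "fst (F (z, k)) \<in> Y"
          using FX[OF zk] by (simp add: mem_Times_iff)
        then show ?thesis
          using L pres[OF q zk] pres[OF xk zk] by (simp add: C2_def p_def)
      qed
      then show "fst q \<in> C1 x"
        using q by (auto simp: C1_def)
    }
    {
      assume R: "fst q \<in> C1 x"
      have "D2 (fst (F q)) z = D2 (p x) z" if z: "z \<in> Y" for z
      proof -
        obtain r where r: "r \<in> X \<times> K" "F r = (z, k)"
          using FY[of "(z, k)"] z K by auto
        then show ?thesis
          using R pres[OF q r(1)] pres[OF xk r(1)] by (auto simp: C1_def p_def)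
      qed
      then show "fst (F q) \<in> C2 (p x)"
        using FX[OF q] by (auto simp: C2_def)
    }
  qed
  have img: "F ` (C1 x \<times> K) = C2 (p x) \<times> K" if x: "x \<in> X" for x
  proof (rule set_eqI, rule iffI)
    fix r assume "r \<in> F ` (C1 x \<times> K)"
    then obtain q where q: "q \<in> C1 x \<times> K" "r = F q"
      by blast
    then have "q \<in> X \<times> K"
      by (auto simp: C1_def)
    then show "r \<in> C2 (p x) \<times> K"
      using q iff[OF _ x] FX by (auto simp: mem_Times_iff)
  next
    fix r assume r: "r \<in> C2 (p x) \<times> K"
    then obtain q where q: "q \<in> X \<times> K" "F q = r"
      using FY[of r] by (auto simp: C2_def)
    then have "q \<in> C1 x \<times> K"
      using r iff[OF q(1) x] by (auto simp: mem_Times_iff)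
    then show "r \<in> F ` (C1 x \<times> K)"
      using q by blast
  qed
  have eqp: "\<exists>b. bij_betw b (C1 x) (C2 (p x))" if x: "x \<in> X" for x
  proof -
    have "inj_on F (C1 x \<times> K)"
      using F by (auto simp: bij_betw_def C1_def intro: inj_on_subset)
    then have "C1 x \<times> K \<approx> C2 (p x) \<times> K"
      unfolding eqpoll_def using img[OF x] by (auto simp: bij_betw_def)
    then show ?thesis
      using eqpoll_times_finite_cancel K unfolding eqpoll_def by blast
  qed
  \<comment> \<open>The bijection is a function of the class itself, so all points of a class use
    the same one, and these bijections fit together to \<open>h\<close>.\<close>
  define \<beta> where "\<beta> C = (SOME b. bij_betw b C (fst ` F ` (C \<times> K)))" for C
  have \<beta>: "bij_betw (\<beta> (C1 x)) (C1 x) (C2 (p x))" if x: "x \<in> X" for x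
  proof -
    have "fst ` F ` (C1 x \<times> K) = C2 (p x)"
      using K unfolding img[OF x] by (auto simp: fst_image_times)
    then show ?thesis
      unfolding \<beta>_def using someI_ex[OF eqp[OF x]] by simp
  qed
  define h where "h x = \<beta> (C1 x) x" for x
  have C1x: "x \<in> C1 x" if "x \<in> X" for x
    using that by (simp add: C1_def)
  have hx: "h x \<in> C2 (p x)" if "x \<in> X" for x
    using bij_betwE[OF \<beta>[OF that]] C1x[OF that] by (simp add: h_def)
  have hY: "h x \<in> Y" if "x \<in> X" for x
    using hx[OF that] by (simp add: C2_def)
  have C1eq: "C1 x = C1 x'" if "x' \<in> C1 x" for x x'
    using that by (auto simp: C1_def)
  have dh: "D2 (h x) (h x') = D1 x x'" if x: "x \<in> X" "x' \<in> X" for x x'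
  proof -
    have "D2 (h x) (h x') = D2 (p x) (h x')"
      using hx[OF x(1)] hY[OF x(2)] by (simp add: C2_def)
    also have "\<dots> = D2 (h x') (p x)"
      using sym pX[OF x(1)] hY[OF x(2)] by blast
    also have "\<dots> = D2 (p x') (p x)"
      using hx[OF x(2)] pX[OF x(1)] by (simp add: C2_def)
    also have "\<dots> = D2 (p x) (p x')"
      using sym pX x by blast
    also have "\<dots> = D1 x x'"
      using pres[of "(x, k)" "(x', k)"] x K by (simp add: p_def)
    finally show ?thesis .
  qed
  have "inj_on h X"
  proof (rule inj_onI)
    fix x x' assume x: "x \<in> X" "x' \<in> X" and eq: "h x = h x'"
    have "D1 x' z = D1 x z" if "z \<in> X" for z
      using dh[OF x(1) that] dh[OF x(2) that] eq by simp
    then have "x' \<in> C1 x"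
      using x by (simp add: C1_def)
    then show "x = x'"
      using eq C1eq C1x x bij_betw_imp_inj_on[OF \<beta>[OF x(1)]] unfolding h_def inj_on_def by metis
  qed
  moreover have "\<exists>x\<in>X. h x = y" if y: "y \<in> Y" for y
  proof -
    obtain q where q: "q \<in> X \<times> K" "F q = (y, k)"
      using FY[of "(y, k)"] y K by auto
    define x where "x = fst q"
    have x: "x \<in> X"
      using q by (auto simp: x_def)
    have "y \<in> C2 (p x)"
      using iff[OF q(1) x] C1x[OF x] q by (simp add: x_def)
    then obtain x' where "x' \<in> C1 x" "\<beta> (C1 x) x' = y"
      using \<beta>[OF x] by (metis bij_betw_imp_surj_on imageE)
    then show ?thesis
      using C1eq by (auto simp: h_def C1_def intro!: bexI[of _ x'])
  qed
  ultimately have "bij_betw h X Y"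
    using hY unfolding bij_betw_def by blast
  then show ?thesis
    using dh by blast
qed

section \<open>Dense sequences in closed sets\<close>

lemma effros_hit:
  assumes "openin (mtopology_of U) V"
  shows "Measurable.pred (effros U) (\<lambda>X. X \<inter> V \<noteq> {})"
proof -
  have "{X \<in> closed_nonempty U. X \<inter> V \<noteq> {}} \<in> sets (effros U)"
    unfolding effros_def using assms by (subst sets_measure_of) auto
  then show ?thesis
    by (simp add: pred_def)
qed

lemma openin_mball_of: "openin (mtopology_of U) (mball_of U x r)"
  by (simp add: mtopology_of_def mball_of_def Metric_space.openin_mball)

text \<open>Index of the centre of the \<open>j\<close>-th ball, of radius
  \<open>(1/2) ^ (l + j)\<close>, in a sequence of balls closing in on a point of \<open>X\<close>.
  It starts at \<open>k\<close> if that ball meets \<open>X\<close>, else at the first one that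
  does, so that every pair \<open>(k, l)\<close> yields a point. Only whether \<open>X\<close> hits
  an open set is asked, which is a Borel question in the Effros structure.\<close>

fun ball_index :: "'u metric \<Rightarrow> (nat \<Rightarrow> 'u) \<Rightarrow> nat \<Rightarrow> nat \<Rightarrow> 'u set \<Rightarrow> nat \<Rightarrow> nat" where
  "ball_index U u k l X 0 =
     (if X \<inter> mball_of U (u k) ((1/2) ^ l) \<noteq> {} then k
      else LEAST n. X \<inter> mball_of U (u n) ((1/2) ^ l) \<noteq> {})"
| "ball_index U u k l X (Suc j) =
     (LEAST n. X \<inter> (mball_of U (u (ball_index U u k l X j)) ((1/2) ^ (l + j)) \<inter>
                     mball_of U (u n) ((1/2) ^ (l + Suc j))) \<noteq> {})"

text \<open>Each index is the least one for which \<open>X\<close> hits a certain open set; the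
  previous index enters through countably many values only.\<close>

lemma measurable_ball_index:
  "(\<lambda>X. ball_index U u k l X j) \<in> effros U \<rightarrow>\<^sub>M count_space UNIV"
proof (induction j)
  case 0
  have [measurable]: "Measurable.pred (effros U) (\<lambda>X. X \<inter> mball_of U (u n) ((1/2) ^ l) \<noteq> {})" for n
    by (rule effros_hit) (rule openin_mball_of)
  show ?case
    unfolding ball_index.simps by measurable
next
  case (Suc j)
  have "Measurable.pred (effros U) (\<lambda>X. X \<inter> (mball_of U (u m) ((1/2) ^ (l + j)) \<inter>
                     mball_of U (u n) ((1/2) ^ (l + Suc j))) \<noteq> {})" for m n
    by (intro effros_hit openin_Int openin_mball_of)
  then have "(\<lambda>X. LEAST n. X \<inter> (mball_of U (u m) ((1/2) ^ (l + j)) \<inter>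
                     mball_of U (u n) ((1/2) ^ (l + Suc j))) \<noteq> {}) \<in> effros U \<rightarrow>\<^sub>M count_space UNIV" for m
    by (rule measurable_Least)
  then show ?case
    unfolding ball_index.simps
    by (rule measurable_compose_countable[OF _ Suc.IH])
qed

context
  fixes U :: "'u metric" and u :: "nat \<Rightarrow> 'u" and X :: "'u set"
  assumes U: "Polish_metric U" and u: "dense_seq U u" and X: "X \<in> closed_nonempty U"
begin

lemma closed_nonempty_subset: "X \<subseteq> mspace U"
  using X closedin_subset by (fastforce simp: closed_nonempty_def)

lemma ball_index_hits:
  "X \<inter> mball_of U (u (ball_index U u k l X j)) ((1/2) ^ (l + j)) \<noteq> {}"
proof (induction j)
  case 0
  obtain x where x: "x \<in> X" "x \<in> mspace U"
    using X closed_nonempty_subset by (auto simp: closed_nonempty_def)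
  obtain n where "mdist U x (u n) < (1/2) ^ l"
    using dense_seq_near[OF u x(2), of "(1/2) ^ l"] by auto
  then have "X \<inter> mball_of U (u n) ((1/2) ^ l) \<noteq> {}"
    using x dense_seq_in[OF u] by (auto simp: mdist_commute)
  then show ?case
    using LeastI[of "\<lambda>n. X \<inter> mball_of U (u n) ((1/2) ^ l) \<noteq> {}"] by auto
next
  case (Suc j)
  then obtain x where x: "x \<in> X" "x \<in> mball_of U (u (ball_index U u k l X j)) ((1/2) ^ (l + j))"
    by blast
  then obtain n where "mdist U x (u n) < (1/2) ^ (l + Suc j)"
    using dense_seq_near[OF u, of x "(1/2) ^ (l + Suc j)"] by auto
  then have "X \<inter> (mball_of U (u (ball_index U u k l X j)) ((1/2) ^ (l + j)) \<inter>
                     mball_of U (u n) ((1/2) ^ (l + Suc j))) \<noteq> {}"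
    using x dense_seq_in[OF u] by (auto simp: mdist_commute)
  from LeastI[of "\<lambda>n. X \<inter> (mball_of U (u (ball_index U u k l X j)) ((1/2) ^ (l + j)) \<inter>
                     mball_of U (u n) ((1/2) ^ (l + Suc j))) \<noteq> {}", OF this]
  show ?case
    by (auto simp del: power_Suc)
qed

text \<open>The two balls share a point of \<open>X\<close>, and the second radius is at most the
  first.\<close>

lemma ball_index_step:
  "mdist U (u (ball_index U u k l X j)) (u (ball_index U u k l X (Suc j))) \<le> 2 * (1/2) ^ (l + j)"
proof -
  let ?i = "ball_index U u k l X"
  obtain x where x: "x \<in> X" "x \<in> mball_of U (u (?i j)) ((1/2) ^ (l + j))"
    using ball_index_hits[of k l j] by blast
  then obtain n where "mdist U x (u n) < (1/2) ^ (l + Suc j)"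
    using dense_seq_near[OF u, of x "(1/2) ^ (l + Suc j)"] by auto
  then have "X \<inter> (mball_of U (u (?i j)) ((1/2) ^ (l + j)) \<inter>
                     mball_of U (u n) ((1/2) ^ (l + Suc j))) \<noteq> {}"
    using x dense_seq_in[OF u] by (auto simp: mdist_commute)
  from LeastI[of "\<lambda>n. X \<inter> (mball_of U (u (?i j)) ((1/2) ^ (l + j)) \<inter>
                     mball_of U (u n) ((1/2) ^ (l + Suc j))) \<noteq> {}", OF this]
  obtain y where y: "y \<in> mspace U" "mdist U (u (?i j)) y < (1/2) ^ (l + j)"
    "mdist U (u (?i (Suc j))) y < (1/2) ^ (l + Suc j)"
    by (auto simp del: power_Suc)
  have "mdist U (u (?i j)) (u (?i (Suc j))) \<le> mdist U (u (?i j)) y + mdist U y (u (?i (Suc j)))"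
    using y dense_seq_in[OF u] by (intro mdist_triangle) auto
  moreover have "(1/2::real) ^ (l + Suc j) \<le> (1/2) ^ (l + j)"
    by (rule power_decreasing) auto
  ultimately show ?thesis
    using y mdist_commute[of U y "u (?i (Suc j))"] by linarith
qed

text \<open>The bound is written as a difference so that the induction telescopes: with
  \<open>r = (1/2) ^ (l + j)\<close> one step costs
  \<open>2 * r = 4 * r - 4 * (r / 2)\<close>.\<close>

lemma ball_index_tail:
  "mdist U (u (ball_index U u k l X j)) (u (ball_index U u k l X (j + p)))
     \<le> 4 * (1/2) ^ (l + j) - 4 * (1/2) ^ (l + (j + p))"
proof (induction p)
  case 0
  then show ?case
    using mdist_zero[OF dense_seq_in[OF u] dense_seq_in[OF u], of "ball_index U u k l X j" "ball_index U u k l X j"]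
    by simp
next
  case (Suc p)
  let ?i = "ball_index U u k l X"
  have "mdist U (u (?i j)) (u (?i (Suc (j + p))))
      \<le> mdist U (u (?i j)) (u (?i (j + p))) + mdist U (u (?i (j + p))) (u (?i (Suc (j + p))))"
    using dense_seq_in[OF u] by (intro mdist_triangle) auto
  moreover have "(1/2::real) ^ (l + (j + p)) = 2 * (1/2) ^ (l + (j + Suc p))"
    by simp
  ultimately show ?case
    using Suc.IH ball_index_step[of k l "j + p"] by (simp del: ball_index.simps)
qed

lemma ball_index_limit:
  "\<exists>y\<in>X. (\<forall>\<epsilon>>0. \<exists>N. \<forall>j\<ge>N. mdist U (u (ball_index U u k l X j)) y < \<epsilon>) \<and>
     mdist U (u (ball_index U u k l X 0)) y \<le> 5 * (1/2) ^ l"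
proof -
  let ?i = "ball_index U u k l X"
  let ?v = "\<lambda>j. u (?i j)"
  note v = dense_seq_in[OF u]
  have half: "\<exists>N. (1/2::real) ^ (l + N) < \<epsilon>" if "\<epsilon> > 0" for \<epsilon>
  proof -
    have "\<exists>N. (1/2::real) ^ N < \<epsilon>"
      using real_arch_pow_inv[OF \<open>\<epsilon> > 0\<close>, of "1/2"] by simp
    then obtain N where "(1/2::real) ^ N < \<epsilon>" ..
    moreover have "(1/2::real) ^ (l + N) \<le> (1/2) ^ N"
      by (rule power_decreasing) auto
    ultimately show ?thesis
      by (meson order_le_less_trans)
  qed
  have tail: "mdist U (?v j) (?v j') \<le> 4 * (1/2) ^ (l + j)" if "j \<le> j'" for j j'
  proof -
    obtain p where "j' = j + p"
      using \<open>j \<le> j'\<close> le_Suc_ex by blast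
    moreover have "0 \<le> 4 * (1/2::real) ^ (l + (j + p))"
      by simp
    ultimately show ?thesis
      using ball_index_tail[of k l j p] unfolding \<open>j' = j + p\<close> by linarith
  qed
  have small: "mdist U (?v j) (?v j') < \<epsilon>" if "8 * (1/2::real) ^ (l + N) < \<epsilon>" "N \<le> j" "N \<le> j'" for N j j' \<epsilon>
    using mdist_triangle[of "?v j" U "?v N" "?v j'", OF v v v] tail[OF that(2)] tail[OF that(3)] that(1)
      mdist_commute[of U "?v j" "?v N"] by linarith
  have "\<forall>\<epsilon>>0. \<exists>N. \<forall>j\<ge>N. \<forall>j'\<ge>N. mdist U (?v j) (?v j') < \<epsilon>"
  proof (intro allI impI)
    fix \<epsilon> :: real assume "\<epsilon> > 0"
    then obtain N where "(1/2::real) ^ (l + N) < \<epsilon> / 8"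
      using half[of "\<epsilon> / 8"] by auto
    then show "\<exists>N. \<forall>j\<ge>N. \<forall>j'\<ge>N. mdist U (?v j) (?v j') < \<epsilon>"
      using small[of N \<epsilon>] by auto
  qed
  moreover have "mcomplete_of U"
    using U by (simp add: Polish_metric_def)
  ultimately obtain y where y: "y \<in> mspace U"
    and lim: "\<And>\<epsilon>. \<epsilon> > 0 \<Longrightarrow> \<exists>N. \<forall>j\<ge>N. mdist U (?v j) y < \<epsilon>"
    using mcomplete_ofD[of U ?v] v by blast
  interpret Metric_space "mspace U" "mdist U" by simp
  \<comment> \<open>The balls around the centres all meet \<open>X\<close> and their radii tend to
    \<open>0\<close>, so the limit is adherent to the closed set \<open>X\<close>.\<close>
  have "y \<in> mtopology closure_of X"
    unfolding metric_closure_of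
  proof (intro CollectI conjI y allI impI)
    fix r :: real assume r: "r > 0"
    then obtain N where N: "\<forall>j\<ge>N. mdist U (?v j) y < r / 2"
      using lim[of "r / 2"] by auto
    obtain K where K: "(1/2::real) ^ (l + K) < r / 2"
      using half[of "r / 2"] r by auto
    define j where "j = max N K"
    have "(1/2::real) ^ (l + j) \<le> (1/2) ^ (l + K)"
      by (rule power_decreasing) (auto simp: j_def)
    then have small_j: "(1/2::real) ^ (l + j) < r / 2"
      using K by linarith
    obtain x where x: "x \<in> X" "x \<in> mspace U" "mdist U (?v j) x < (1/2) ^ (l + j)"
      using ball_index_hits[of k l j] by auto
    have "mdist U y x \<le> mdist U y (?v j) + mdist U (?v j) x"
      by (rule mdist_triangle) (use x y v in auto)
    moreover have "mdist U y (?v j) < r / 2"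
      using N by (simp add: j_def mdist_commute)
    ultimately have "mdist U y x < r"
      using x small_j by linarith
    then show "\<exists>x\<in>X. x \<in> mball y r"
      using x y by auto
  qed
  then have yX: "y \<in> X"
    using X by (simp add: closed_nonempty_def mtopology_of_def closure_of_closedin)
  \<comment> \<open>At most \<open>4 * (1/2) ^ l\<close> along the centres, and one further
    \<open>(1/2) ^ l\<close> to the limit.\<close>
  have "mdist U (?v 0) y \<le> 5 * (1/2) ^ l"
  proof -
    obtain N where N: "\<forall>j\<ge>N. mdist U (?v j) y < (1/2) ^ l"
      using lim[of "(1/2) ^ l"] by auto
    have "mdist U (?v 0) y \<le> mdist U (?v 0) (?v N) + mdist U (?v N) y"
      by (rule mdist_triangle) (use y v in auto)
    then show ?thesis
      using N[rule_format, of N] tail[of 0 N] by simp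
  qed
  then show ?thesis
    using yX lim by blast
qed

end

text \<open>The \<open>i\<close>-th point is the limit of the centres that start from the pair
  \<open>(k, l)\<close> coded by \<open>i\<close>. Only the mutual distances of the chosen points
  are claimed to be Borel, which is all that the later construction reads.\<close>

lemma effros_dense_selectors:
  fixes U :: "'u metric"
  assumes U: "Polish_metric U"
  obtains e :: "'u set \<Rightarrow> nat \<Rightarrow> 'u" where
    "\<And>X. X \<in> closed_nonempty U \<Longrightarrow> dense_seq (submetric U X) (e X)"
    "\<And>i j. (\<lambda>X. mdist U (e X i) (e X j)) \<in> borel_measurable (effros U)"
proof -
  obtain u where u: "dense_seq U u"
    using Polish_metric_dense_seq[OF U] .
  define idx where "idx i X = ball_index U u (fst (prod_decode i)) (snd (prod_decode i)) X" for i X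
  define e where "e X i = (SOME y. y \<in> X \<and> (\<forall>\<epsilon>>0. \<exists>N. \<forall>j\<ge>N. mdist U (u (idx i X j)) y < \<epsilon>) \<and>
     mdist U (u (idx i X 0)) y \<le> 5 * (1/2) ^ snd (prod_decode i))" for X i
  have "e X i \<in> X \<and> (\<forall>\<epsilon>>0. \<exists>N. \<forall>j\<ge>N. mdist U (u (idx i X j)) (e X i) < \<epsilon>) \<and>
     mdist U (u (idx i X 0)) (e X i) \<le> 5 * (1/2) ^ snd (prod_decode i)"
    if "X \<in> closed_nonempty U" for X i
    unfolding e_def
    by (rule someI_ex)
      (use ball_index_limit[OF U u that, of "fst (prod_decode i)" "snd (prod_decode i)"]
        in \<open>auto simp: idx_def simp del: ball_index.simps\<close>)
  then have e: "e X i \<in> X" "\<epsilon> > 0 \<Longrightarrow> \<exists>N. \<forall>j\<ge>N. mdist U (u (idx i X j)) (e X i) < \<epsilon>"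
     "mdist U (u (idx i X 0)) (e X i) \<le> 5 * (1/2) ^ snd (prod_decode i)"
    if "X \<in> closed_nonempty U" for X i \<epsilon>
    using that by auto
  have "dense_seq (submetric U X) (e X)" if X: "X \<in> closed_nonempty U" for X
    unfolding dense_seq_def
  proof (intro conjI allI ballI impI)
    note sub = closed_nonempty_subset[OF U u X]
    show "e X i \<in> mspace (submetric U X)" for i
      using e(1)[OF X] sub by auto
    fix x and \<epsilon> :: real assume x: "x \<in> mspace (submetric U X)" and \<epsilon>: "\<epsilon> > 0"
    \<comment> \<open>The start is within \<open>(1/2) ^ l\<close> of \<open>x\<close> and the limit
      within \<open>5 * (1/2) ^ l\<close> of the start, hence the \<open>6\<close>.\<close>
    obtain l where l: "(1/2::real) ^ l < \<epsilon> / 6"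
      using real_arch_pow_inv[of "\<epsilon> / 6" "1/2"] \<epsilon> by auto
    obtain k where k: "mdist U x (u k) < (1/2) ^ l"
      using dense_seq_near[OF u, of x "(1/2) ^ l"] x by auto
    define i where "i = prod_encode (k, l)"
    have "X \<inter> mball_of U (u k) ((1/2) ^ l) \<noteq> {}"
      using x k dense_seq_in[OF u] by (auto simp: mdist_commute)
    then have "idx i X 0 = k"
      by (simp add: idx_def i_def)
    then have "mdist U (u k) (e X i) \<le> 5 * (1/2) ^ l"
      using e(3)[OF X, of i] by (simp add: i_def)
    moreover have "mdist U x (e X i) \<le> mdist U x (u k) + mdist U (u k) (e X i)"
      by (rule mdist_triangle) (use x e(1)[OF X] sub dense_seq_in[OF u] in auto)
    ultimately show "\<exists>i. mdist (submetric U X) x (e X i) < \<epsilon>"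
      using k l by (intro exI[of _ i]) simp
  qed
  \<comment> \<open>Distances between limits are pointwise limits of distances between centres, and
    these are functions of Borel indices with countably many values.\<close>
  moreover have "(\<lambda>X. mdist U (e X i) (e X i')) \<in> borel_measurable (effros U)" for i i'
  proof (rule borel_measurable_LIMSEQ_real)
    fix X assume "X \<in> space (effros U)"
    then have X: "X \<in> closed_nonempty U"
      by simp
    note sub = closed_nonempty_subset[OF U u X]
    interpret Metric_space "mspace U" "mdist U" by simp
    have in_U: "e X i \<in> mspace U" for i
      using e(1)[OF X] sub by auto
    show "(\<lambda>j. mdist U (u (idx i X j)) (u (idx i' X j))) \<longlonglongrightarrow> mdist U (e X i) (e X i')"
      unfolding LIMSEQ_def
    proof (intro allI impI)
      fix r :: real assume "r > 0"
      then obtain N N' where N: "\<forall>j\<ge>N. mdist U (u (idx i X j)) (e X i) < r / 2"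
        and N': "\<forall>j\<ge>N'. mdist U (u (idx i' X j)) (e X i') < r / 2"
        using e(2)[OF X, of "r / 2"] by (meson half_gt_zero)
      have "dist (mdist U (u (idx i X j)) (u (idx i' X j))) (mdist U (e X i) (e X i')) < r"
        if j: "j \<ge> max N N'" for j
      proof -
        note uj = dense_seq_in[OF u, of "idx i X j"] and uj' = dense_seq_in[OF u, of "idx i' X j"]
        have "mdist U (u (idx i X j)) (e X i) < r / 2" "mdist U (u (idx i' X j)) (e X i') < r / 2"
          using N N' j by auto
        then show ?thesis
          using mdist_reverse_triangle[OF uj uj' in_U[of i]]
            mdist_reverse_triangle[OF uj' in_U[of i] in_U[of i']]
          unfolding dist_real_def by linarith
      qed
      then show "\<exists>no. \<forall>n\<ge>no. dist (mdist U (u (idx i X n)) (u (idx i' X n))) (mdist U (e X i) (e X i')) < r"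
        by blast
    qed
  next
    fix j
    have m: "(\<lambda>X. idx i X j) \<in> effros U \<rightarrow>\<^sub>M count_space UNIV" for i
      unfolding idx_def by (rule measurable_ball_index)
    have "(\<lambda>X. mdist U (u n) (u (idx i' X j))) \<in> borel_measurable (effros U)" for n
      by (rule measurable_compose[OF m]) simp
    then show "(\<lambda>X. mdist U (u (idx i X j)) (u (idx i' X j))) \<in> borel_measurable (effros U)"
      by (rule measurable_compose_countable[OF _ m])
  qed
  ultimately show thesis
    using that by blast
qed

section \<open>Borel families of subspaces of the Urysohn space\<close>

text \<open>Universality puts a copy of \<open>M\<close> into \<open>U\<close>, and ultrahomogeneity
  moves the copies of the first \<open>n\<close> points onto the points \<open>h i\<close>;
  \<open>u\<close> is where the copy of \<open>e n\<close> goes.\<close>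

lemma Urysohn_one_point_extension:
  fixes M :: "'b metric" and U :: "'u metric"
  assumes U: "Urysohn_metric U" and M: "Polish_metric M" and e: "\<And>i. e i \<in> mspace M"
    and h: "\<And>i. i < n \<Longrightarrow> h i \<in> mspace U"
    and d: "\<And>i j. i < n \<Longrightarrow> j < n \<Longrightarrow> mdist U (h i) (h j) = mdist M (e i) (e j)"
  shows "\<exists>u\<in>mspace U. \<forall>i<n. mdist U (h i) u = mdist M (e i) (e (n::nat))"
proof -
  obtain J where "isometric_embedding M U J"
    using Urysohn_metric_universal[OF U M] by blast
  then have J: "\<And>i. J (e i) \<in> mspace U" "\<And>i j. mdist U (J (e i)) (J (e j)) = mdist M (e i) (e j)"
    using e by (auto simp: isometric_embedding_def)
  define S where "S = (\<lambda>i. J (e i)) ` {..<n}"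
  \<comment> \<open>Several indices may give the same point of \<open>S\<close>, so one is chosen;
    any other choice gives the same \<open>h i\<close>, being at distance \<open>0\<close> from
    it.\<close>
  define k where "k s = h (SOME i. i < n \<and> J (e i) = s)" for s
  have k: "k (J (e i)) = h i" if i: "i < n" for i
  proof -
    define i' where "i' = (SOME i'. i' < n \<and> J (e i') = J (e i))"
    have "i' < n \<and> J (e i') = J (e i)"
      unfolding i'_def using i by (intro someI[of "\<lambda>i'. i' < n \<and> J (e i') = J (e i)" i]) simp
    then have i': "i' < n" "J (e i') = J (e i)"
      by auto
    have "mdist U (h i') (h i) = 0"
      using d[OF i'(1) i] J(2)[of i' i] i'(2) mdist_zero[OF J(1)[of i] J(1)[of i]] by simp
    then show ?thesis
      using h i i' by (simp add: k_def i'_def)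
  qed
  have SU: "S \<subseteq> mspace U"
    using J(1) e by (auto simp: S_def)
  have "isometric_embedding (submetric U S) U k"
    unfolding isometric_embedding_def
  proof (intro conjI ballI)
    show "k ` mspace (submetric U S) \<subseteq> mspace U"
      using k h by (auto simp: S_def)
    fix x y assume "x \<in> mspace (submetric U S)" "y \<in> mspace (submetric U S)"
    then obtain i j where "i < n" "x = J (e i)" "j < n" "y = J (e j)"
      by (auto simp: S_def)
    then show "mdist U (k x) (k y) = mdist (submetric U S) x y"
      using k d J(2) e by simp
  qed
  moreover have "finite S"
    by (simp add: S_def)
  ultimately obtain g where g: "isometry U U g" "\<And>x. x \<in> S \<Longrightarrow> g x = k x"
    using U SU unfolding Urysohn_metric_def ultrahomogeneous_def by metis
  have "mdist U (h i) (g (J (e n))) = mdist M (e i) (e n)" if i: "i < n" for i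
  proof -
    have "g (J (e i)) = h i"
      using g(2)[of "J (e i)"] k[OF i] i by (auto simp: S_def)
    then show ?thesis
      using isometryD(3)[OF g(1) J(1)[of i] J(1)[of n]] J(2)[of i n] by simp
  qed
  moreover have "g (J (e n)) \<in> mspace U"
    by (rule isometryD(1)[OF g(1) J(1)])
  ultimately show ?thesis
    by blast
qed

text \<open>The first \<open>n\<close> points are kept as a list, so that the next choice is a
  function of a finite object: this list and the \<open>n\<close> distances to be realized.\<close>

primrec greedy_points :: "'u metric \<Rightarrow> (nat \<Rightarrow> nat \<Rightarrow> real) \<Rightarrow> nat \<Rightarrow> 'u list" where
  "greedy_points U \<rho> 0 = []"
| "greedy_points U \<rho> (Suc n) = greedy_points U \<rho> n @
     [SOME u. u \<in> mspace U \<and> (\<forall>i<n. mdist U (greedy_points U \<rho> n ! i) u = \<rho> i n)]"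

definition greedy_point :: "'u metric \<Rightarrow> (nat \<Rightarrow> nat \<Rightarrow> real) \<Rightarrow> nat \<Rightarrow> 'u" where
  "greedy_point U \<rho> n = greedy_points U \<rho> (Suc n) ! n"

lemma length_greedy_points [simp]: "length (greedy_points U \<rho> n) = n"
  by (induction n) auto

lemma greedy_points_nth: "i < n \<Longrightarrow> greedy_points U \<rho> n ! i = greedy_point U \<rho> i"
proof (induction n)
  case (Suc n)
  then show ?case
    by (cases "i = n") (auto simp: nth_append greedy_point_def)
qed simp

text \<open>By induction the points placed so far copy the first points of \<open>e\<close>, so by
  one-point extension every choice succeeds.\<close>

lemma greedy_point_dist:
  fixes M :: "'b metric" and U :: "'u metric"
  assumes U: "Urysohn_metric U" and M: "Polish_metric M" and e: "\<And>i. e i \<in> mspace M"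
    and \<rho>: "\<And>i j. \<rho> i j = mdist M (e i) (e j)"
  shows "greedy_point U \<rho> i \<in> mspace U"
    and "mdist U (greedy_point U \<rho> i) (greedy_point U \<rho> j) = mdist M (e i) (e j)"
proof -
  let ?h = "greedy_point U \<rho>"
  have main: "(\<forall>i<n. ?h i \<in> mspace U) \<and>
    (\<forall>i<n. \<forall>j<n. mdist U (?h i) (?h j) = mdist M (e i) (e j))" for n
  proof (induction n)
    case (Suc n)
    have ext: "\<exists>u. u \<in> mspace U \<and> (\<forall>i<n. mdist U (?h i) u = \<rho> i n)"
    proof -
      have "\<exists>u\<in>mspace U. \<forall>i<n. mdist U (?h i) u = mdist M (e i) (e n)"
        by (rule Urysohn_one_point_extension[OF U M e]) (use Suc.IH in simp_all)
      then show ?thesis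
        by (simp only: \<rho> Bex_def)
    qed
    have "?h n = (SOME u. u \<in> mspace U \<and> (\<forall>i<n. mdist U (?h i) u = \<rho> i n))"
      by (simp add: greedy_point_def[of U \<rho> n] nth_append greedy_points_nth cong: conj_cong)
    then have hn: "?h n \<in> mspace U" "\<And>i. i < n \<Longrightarrow> mdist U (?h i) (?h n) = mdist M (e i) (e n)"
      using someI_ex[OF ext] \<rho> by auto
    moreover have "mdist U (?h n) (?h n) = mdist M (e n) (e n)"
      using hn(1) e by (metis mdist_zero)
    moreover have "mdist U (?h n) (?h i) = mdist M (e n) (e i)" if "i < n" for i
      using hn(2)[OF that] by (simp add: mdist_commute)
    ultimately show ?case
      using Suc by (auto simp: less_Suc_eq)
  qed simp
  show "?h i \<in> mspace U"
    using main[of "Suc i"] by simp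
  show "mdist U (?h i) (?h j) = mdist M (e i) (e j)"
    using main[of "Suc (max i j)"] by simp
qed

text \<open>Measurability without a measurable structure on the range. It is preserved by arbitrary
  functions, so it survives the choices made for lists of points.\<close>

definition countably_valued :: "'a measure \<Rightarrow> ('a \<Rightarrow> 'b) \<Rightarrow> bool" where
  "countably_valued N f \<longleftrightarrow>
     countable (f ` space N) \<and> (\<forall>v. {x \<in> space N. f x = v} \<in> sets N)"

lemma countably_valued_const: "countably_valued N (\<lambda>x. c)"
proof -
  have "{x \<in> space N. c = v} = (if c = v then space N else {})" for v
    by auto
  then show ?thesis
    by (auto simp: countably_valued_def intro: countable_subset[of _ "{c}"])
qed

text \<open>\<open>F\<close> can be arbitrary: the preimage of a value is a countable union of
  intersections of fibres of \<open>f\<close> and \<open>g\<close>.\<close>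

lemma countably_valued_combine:
  assumes f: "countably_valued N f" and g: "countably_valued N g"
  shows "countably_valued N (\<lambda>x. F (f x) (g x))"
  unfolding countably_valued_def
proof (intro conjI allI)
  let ?I = "f ` space N \<times> g ` space N"
  have I: "countable ?I"
    using f g by (auto simp: countably_valued_def)
  show "countable ((\<lambda>x. F (f x) (g x)) ` space N)"
    by (rule countable_subset[OF _ countable_image[OF I, of "\<lambda>(a, b). F a b"]]) auto
  fix v
  have "{x \<in> space N. F (f x) (g x) = v} =
      (\<Union>a\<in>f ` space N. \<Union>b\<in>g ` space N. {x \<in> space N. f x = a \<and> g x = b \<and> F a b = v})"
    by (rule set_eqI) auto
  also have "\<dots> \<in> sets N"
  proof (intro sets.countable_UN'')
    fix a b
    have "{x \<in> space N. f x = a \<and> g x = b \<and> F a b = v} =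
        (if F a b = v then {x \<in> space N. f x = a} \<inter> {x \<in> space N. g x = b} else {})"
      by auto
    then show "{x \<in> space N. f x = a \<and> g x = b \<and> F a b = v} \<in> sets N"
      using f g by (simp add: countably_valued_def sets.Int)
  qed (use f g in \<open>auto simp: countably_valued_def\<close>)
  finally show "{x \<in> space N. F (f x) (g x) = v} \<in> sets N" .
qed

lemma countably_valued_pred:
  assumes "countably_valued N f"
  shows "{x \<in> space N. Q (f x)} \<in> sets N"
  using countably_valued_combine[OF assms assms, of "\<lambda>a _. Q a"]
  by (auto simp: countably_valued_def elim!: allE[of _ True])

lemma countably_valued_real:
  assumes "f \<in> borel_measurable N" "f ` space N \<subseteq> A" "countable (A :: real set)"
  shows "countably_valued N f"
proof -
  have "{x \<in> space N. f x = v} \<in> sets N" for v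
    using assms(1) by measurable
  then show ?thesis
    using assms(2,3) countable_subset by (auto simp: countably_valued_def)
qed

lemma countably_valued_greedy_points:
  assumes \<rho>: "\<And>i j. countably_valued N (\<lambda>x. \<rho> x i j)"
  shows "countably_valued N (\<lambda>x. greedy_points U (\<rho> x) n)"
proof (induction n)
  case 0
  then show ?case
    by (simp add: countably_valued_const)
next
  case (Suc n)
  have row: "countably_valued N (\<lambda>x. map (\<lambda>i. \<rho> x i n) [0..<k])" for k
  proof (induction k)
    case 0
    then show ?case
      by (simp add: countably_valued_const)
  next
    case (Suc k)
    then show ?case
      using countably_valued_combine[OF Suc \<rho>[of k n], of "\<lambda>l r. l @ [r]"] by simp
  qed
  \<comment> \<open>The next list is one fixed function of the previous list and of the row of
    \<open>n\<close> distances.\<close>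
  have "greedy_points U (\<rho> x) (Suc n) = (\<lambda>l r. l @
     [SOME u. u \<in> mspace U \<and> (\<forall>i<n. mdist U (l ! i) u = r ! i)])
       (greedy_points U (\<rho> x) n) (map (\<lambda>i. \<rho> x i n) [0..<n])" for x
    by (simp cong: conj_cong)
  then show ?case
    using countably_valued_combine[OF Suc row, of "\<lambda>l r. l @
     [SOME u. u \<in> mspace U \<and> (\<forall>i<n. mdist U (l ! i) u = r ! i)]" n] by presburger
qed

text \<open>Since \<open>A\<close> is countable, every finite stage of the greedy construction takes
  countably many values, so its points depend on \<open>x\<close> in a Borel way. The closed set
  \<open>g x\<close> is the closure of these points.\<close>

lemma Borel_realization:
  fixes \<Phi> :: "'a \<Rightarrow> 'b metric" and U :: "'u metric"
  assumes U: "Urysohn_metric U" and A: "countable A"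
    and \<Phi>: "\<And>x. x \<in> space N \<Longrightarrow> Polish_metric (\<Phi> x)"
    and e: "\<And>x. x \<in> space N \<Longrightarrow> dense_seq (\<Phi> x) (e x)"
    and D: "\<And>x. x \<in> space N \<Longrightarrow> dist_values (\<Phi> x) \<subseteq> A"
    and meas: "\<And>i j. (\<lambda>x. mdist (\<Phi> x) (e x i) (e x j)) \<in> borel_measurable N"
  obtains g where "g \<in> N \<rightarrow>\<^sub>M effros U"
    and "\<And>x. x \<in> space N \<Longrightarrow> isometric (\<Phi> x) (submetric U (g x))"
proof -
  have PU: "Polish_metric U"
    using U by (simp add: Urysohn_metric_def)
  define \<rho> where "\<rho> x i j = mdist (\<Phi> x) (e x i) (e x j)" for x i j
  define h where "h x = greedy_point U (\<rho> x)" for x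
  define g where "g x = mtopology_of U closure_of (range (h x))" for x
  have h: "h x i \<in> mspace U" "mdist U (h x i) (h x j) = mdist (\<Phi> x) (e x i) (e x j)"
    if x: "x \<in> space N" for x i j
    unfolding h_def
    using greedy_point_dist[of U "\<Phi> x" "e x" "\<rho> x", OF U \<Phi>[OF x] dense_seq_in[OF e[OF x]]]
    by (simp_all add: \<rho>_def)
  have g: "g x \<in> closed_nonempty U" if x: "x \<in> space N" for x
  proof -
    have "range (h x) \<subseteq> g x"
      unfolding g_def by (rule closure_of_subset) (use h(1)[OF x] in auto)
    then show ?thesis
      by (auto simp: closed_nonempty_def g_def)
  qed
  have "countably_valued N (\<lambda>x. \<rho> x i j)" for i j
    unfolding \<rho>_def
  proof (rule countably_valued_real[OF meas _ A])
    show "(\<lambda>x. mdist (\<Phi> x) (e x i) (e x j)) ` space N \<subseteq> A"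
      using D dense_seq_in[OF e] mdist_in_dist_values by fast
  qed
  then have "countably_valued N (\<lambda>x. greedy_points U (\<rho> x) n)" for n
    by (rule countably_valued_greedy_points)
  from countably_valued_pred[OF this]
  have hV: "{x \<in> space N. h x n \<in> V} \<in> sets N" for n V
    unfolding h_def greedy_point_def .
  have "g \<in> N \<rightarrow>\<^sub>M effros U"
    unfolding effros_def
  proof (rule measurable_measure_of)
    show "g \<in> space N \<rightarrow> closed_nonempty U"
      using g by blast
    fix Y assume "Y \<in> {{X \<in> closed_nonempty U. X \<inter> V \<noteq> {}} |V. openin (mtopology_of U) V}"
    then obtain V where V: "openin (mtopology_of U) V" and Y: "Y = {X \<in> closed_nonempty U. X \<inter> V \<noteq> {}}"
      by blast
    \<comment> \<open>An open set meets a closure iff it contains one of the points; this turns a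
      generator of the Effros structure into a countable union.\<close>
    have "g x \<inter> V \<noteq> {} \<longleftrightarrow> (\<exists>n. h x n \<in> V)" for x
      using openin_Int_closure_of_eq_empty[OF V, of "range (h x)"] unfolding g_def by blast
    then have "g -` Y \<inter> space N = (\<Union>n. {x \<in> space N. h x n \<in> V})"
      using g unfolding Y by auto
    then show "g -` Y \<inter> space N \<in> sets N"
      using hV by auto
  qed auto
  moreover have "isometric (\<Phi> x) (submetric U (g x))" if x: "x \<in> space N" for x
  proof (rule isometric_of_dense_seqs)
    interpret Metric_space "mspace U" "mdist U" by simp
    have gU: "g x \<subseteq> mspace U"
      using closure_of_subset_topspace[of "mtopology_of U"] by (auto simp: g_def)
    have hg: "h x i \<in> g x" for i
      using closure_of_subset[of "range (h x)" "mtopology_of U"] h(1)[OF x] by (auto simp: g_def)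
    show dense: "dense_seq (submetric U (g x)) (h x)"
      using gU hg unfolding dense_seq_def g_def mtopology_of_def metric_closure_of
      by (auto simp: subset_iff)
    show "mcomplete_of (\<Phi> x)"
      using \<Phi>[OF x] by (simp add: Polish_metric_def)
    show "mcomplete_of (submetric U (g x))"
      using Polish_submetric[OF PU g[OF x] dense] by (simp add: Polish_metric_def)
    show "dense_seq (\<Phi> x) (e x)"
      by (rule e[OF x])
    show "mdist (submetric U (g x)) (h x i) (h x j) = mdist (\<Phi> x) (e x i) (e x j)" for i j
      using h(2)[OF x] by simp
  qed
  ultimately show thesis
    using that by blast
qed

section \<open>Layered spaces\<close>

definition same_layer_ball :: "(real \<Rightarrow> real) \<Rightarrow> 'a metric \<Rightarrow> real \<Rightarrow> 'a \<Rightarrow> 'a \<Rightarrow> bool" where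
  "same_layer_ball s M a x y \<longleftrightarrow> (\<forall>z\<in>mspace M. mdist M x z \<le> s a \<longleftrightarrow> mdist M y z \<le> s a)"

definition layer_dist :: "(real \<Rightarrow> real) \<Rightarrow> 'a metric \<Rightarrow> 'a \<times> real \<Rightarrow> 'a \<times> real \<Rightarrow> real" where
  "layer_dist s M p q = max (mdist M (fst p) (fst q))
     (if snd p = snd q \<and> same_layer_ball s M (snd p) (fst p) (fst q) then 0 else max (snd p) (snd q))"

definition layered :: "real set \<Rightarrow> (real \<Rightarrow> real) \<Rightarrow> 'a metric \<Rightarrow> ('a \<times> real) metric" where
  "layered A s M = metric (mspace M \<times> A, layer_dist s M)"

lemma same_layer_ball_refl: "same_layer_ball s M a x x"
  by (simp add: same_layer_ball_def)

lemma same_layer_ball_sym: "same_layer_ball s M a x y \<longleftrightarrow> same_layer_ball s M a y x"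
  by (auto simp: same_layer_ball_def)

lemma same_layer_ball_trans:
  "same_layer_ball s M a x y \<Longrightarrow> same_layer_ball s M a y z \<Longrightarrow> same_layer_ball s M a x z"
  by (auto simp: same_layer_ball_def)

text \<open>\<open>B\<close> bounds the distances of the base space; \<open>A\<close> supplies the
  layers and the values to be realized. By \<open>gap\<close>, balls of radius \<open>s a\<close> do
  not change when the centre moves by less than \<open>\<delta> a\<close>. By \<open>skip\<close>,
  layer \<open>a\<close> misses a positive value below \<open>a\<close> as soon as \<open>A\<close>
  has one there.\<close>

locale layering =
  fixes A B :: "real set" and s \<delta> :: "real \<Rightarrow> real"
  assumes zero_A: "0 \<in> A" and nonneg_A: "a \<in> A \<Longrightarrow> 0 \<le> a" and B_sub: "B \<subseteq> A"
    and s_nonneg: "a \<in> A \<Longrightarrow> 0 < a \<Longrightarrow> 0 \<le> s a"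
    and \<delta>_pos: "a \<in> A \<Longrightarrow> 0 < a \<Longrightarrow> 0 < \<delta> a"
    and gap: "a \<in> A \<Longrightarrow> 0 < a \<Longrightarrow> t \<in> B \<Longrightarrow> t \<le> s a \<or> s a + \<delta> a \<le> t"
    and skip: "a \<in> A \<Longrightarrow> b' \<in> A \<Longrightarrow> 0 < b' \<Longrightarrow> b' < a \<Longrightarrow>
      \<exists>b\<in>A. 0 < b \<and> b < a \<and> (\<forall>t\<in>B. t \<le> s a \<longrightarrow> t \<noteq> b)"
begin

lemma layered_metric:
  fixes M :: "'a metric"
  shows "Metric_space (mspace M \<times> A) (layer_dist s M)"
proof
  let ?L = "layer_dist s M"
  show "0 \<le> ?L p q" for p q
    by (simp add: layer_dist_def max.coboundedI1)
  show "?L p q = ?L q p" for p q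
    using same_layer_ball_sym[of s M "snd p" "fst p" "fst q"]
    by (auto simp: layer_dist_def mdist_commute max.commute)
  show "?L p q = 0 \<longleftrightarrow> p = q" if p: "p \<in> mspace M \<times> A" and q: "q \<in> mspace M \<times> A" for p q
  proof
    assume 0: "?L p q = 0"
    have nn: "0 \<le> snd p" "0 \<le> snd q" "fst p \<in> mspace M" "fst q \<in> mspace M"
      using p q nonneg_A by auto
    have "mdist M (fst p) (fst q) \<le> 0"
      using 0 by (simp add: layer_dist_def split: if_splits)
    then have "mdist M (fst p) (fst q) = 0"
      by (simp add: order_antisym)
    then have f: "fst p = fst q"
      using nn by simp
    moreover have "snd p = snd q"
    proof (rule ccontr)
      assume "snd p \<noteq> snd q"
      then have "max (snd p) (snd q) \<le> ?L p q"
        by (simp add: layer_dist_def)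
      then show False
        using 0 nn \<open>snd p \<noteq> snd q\<close> by auto
    qed
    ultimately show "p = q"
      by (simp add: prod_eq_iff)
  next
    assume "p = q"
    then show "?L p q = 0"
      using p by (auto simp: layer_dist_def same_layer_ball_refl)
  qed
  show "?L p r \<le> ?L p q + ?L q r"
    if p: "p \<in> mspace M \<times> A" and q: "q \<in> mspace M \<times> A" and r: "r \<in> mspace M \<times> A" for p q r
  proof -
    \<comment> \<open>\<open>u\<close> satisfies the strong triangle inequality, and its maximum
      with a metric satisfies the ordinary one.\<close>
    define u where "u p q = (if snd p = snd q \<and> same_layer_ball s M (snd p) (fst p) (fst q) then 0
      else max (snd p) (snd q))" for p q :: "'a \<times> real"
    have L: "?L p q = max (mdist M (fst p) (fst q)) (u p q)" for p q
      by (simp add: layer_dist_def u_def)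
    have nn: "0 \<le> snd p" "0 \<le> snd q" "0 \<le> snd r"
      using p q r nonneg_A by auto
    have "u p r \<le> max (u p q) (u q r)"
      using nn same_layer_ball_trans[of s M "snd p" "fst p" "fst q" "fst r"]
      by (auto simp: u_def)
    moreover have "mdist M (fst p) (fst r) \<le> mdist M (fst p) (fst q) + mdist M (fst q) (fst r)"
      using p q r by (intro mdist_triangle) auto
    moreover have "0 \<le> u p q" "0 \<le> u q r"
      using nn by (auto simp: u_def)
    moreover have "0 \<le> mdist M (fst p) (fst q)" "0 \<le> mdist M (fst q) (fst r)"
      by simp_all
    ultimately show ?thesis
      unfolding L by linarith
  qed
qed

lemma mspace_layered [simp]: "mspace (layered A s M) = mspace M \<times> A"
  by (simp add: layered_def Metric_space.mspace_metric[OF layered_metric])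

lemma mdist_layered [simp]: "mdist (layered A s M) = layer_dist s M"
  by (simp add: layered_def Metric_space.mdist_metric[OF layered_metric])

section \<open>Layered spaces over a base with distances in \<open>B\<close>\<close>

context
  fixes M :: "'a metric"
  assumes DM: "dist_values M \<subseteq> B"
begin

text \<open>Moving the centre by less than \<open>\<delta> a\<close> changes the distance to
  \<open>z\<close> by less than \<open>\<delta> a\<close>, too little to cross the gap above
  \<open>s a\<close>.\<close>

lemma same_layer_ball_close:
  assumes a: "a \<in> A" "0 < a" and x: "x \<in> mspace M" "y \<in> mspace M" and d: "mdist M x y < \<delta> a"
  shows "same_layer_ball s M a x y"
proof -
  have "mdist M y z \<le> s a" if "mdist M x z \<le> s a" "z \<in> mspace M" "x \<in> mspace M" "y \<in> mspace M"
    "mdist M x y < \<delta> a" for x y z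
  proof -
    have "mdist M y z \<le> mdist M y x + mdist M x z"
      using that by (intro mdist_triangle) auto
    then have "mdist M y z < s a + \<delta> a"
      using that by (simp add: mdist_commute)
    moreover have "mdist M y z \<in> B"
      using subsetD[OF DM mdist_in_dist_values] that by simp
    ultimately show ?thesis
      using gap[OF a] by force
  qed
  then have "mdist M x z \<le> s a \<longleftrightarrow> mdist M y z \<le> s a" if "z \<in> mspace M" for z
    using that x d mdist_commute[of M x y] by metis
  then show ?thesis
    by (simp add: same_layer_ball_def)
qed

lemma same_layer_ball_dist:
  assumes a: "a \<in> A" "0 < a" and x: "x \<in> mspace M" "y \<in> mspace M" and r: "same_layer_ball s M a x y"
  shows "mdist M x y \<le> s a"
proof -
  have "mdist M y y \<le> s a"
    using s_nonneg[OF a] mdist_zero[OF x(2) x(2)] by simp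
  then show ?thesis
    using r x by (simp add: same_layer_ball_def)
qed

text \<open>Points closer than \<open>\<delta> a\<close> lie in the same closed balls of radius
  \<open>s a\<close>, so a dense sequence suffices for testing. This turns the relation into
  countably many Borel conditions.\<close>

lemma same_layer_ball_dense_iff:
  assumes e: "dense_seq M e" and a: "a \<in> A" "0 < a" and x: "x \<in> mspace M" "y \<in> mspace M"
  shows "same_layer_ball s M a x y \<longleftrightarrow> (\<forall>n. mdist M x (e n) \<le> s a \<longleftrightarrow> mdist M y (e n) \<le> s a)"
proof
  assume R: "\<forall>n. mdist M x (e n) \<le> s a \<longleftrightarrow> mdist M y (e n) \<le> s a"
  show "same_layer_ball s M a x y"
    unfolding same_layer_ball_def
  proof
    fix z assume z: "z \<in> mspace M"
    then obtain n where "mdist M z (e n) < \<delta> a"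
      using dense_seq_near[OF e z \<delta>_pos[OF a]] by blast
    then have "same_layer_ball s M a z (e n)"
      using same_layer_ball_close[OF a z dense_seq_in[OF e]] by blast
    then have "mdist M x z \<le> s a \<longleftrightarrow> mdist M x (e n) \<le> s a"
      "mdist M y z \<le> s a \<longleftrightarrow> mdist M y (e n) \<le> s a"
      using x by (auto simp: same_layer_ball_def mdist_commute)
    then show "mdist M x z \<le> s a \<longleftrightarrow> mdist M y z \<le> s a"
      using R by simp
  qed
qed (use dense_seq_in[OF e] in \<open>simp add: same_layer_ball_def\<close>)

lemma layer_dist_close:
  assumes a: "a \<in> A" and x: "x \<in> mspace M" "y \<in> mspace M" and d: "0 < a \<Longrightarrow> mdist M x y < \<delta> a"
  shows "layer_dist s M (x, a) (y, a) = mdist M x y"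
proof (cases "a = 0")
  case False
  then show ?thesis
    using same_layer_ball_close[OF a _ x] nonneg_A[OF a] d by (simp add: layer_dist_def)
qed (simp add: layer_dist_def)

text \<open>A point is approximated inside its own layer, where small distances are those of
  \<open>M\<close>.\<close>

lemma dense_seq_layered:
  assumes e: "dense_seq M e" and c: "range c = A"
  shows "dense_seq (layered A s M) (\<lambda>i. (e (fst (prod_decode i)), c (snd (prod_decode i))))"
  unfolding dense_seq_def
proof (intro conjI allI ballI impI)
  show "(e (fst (prod_decode i)), c (snd (prod_decode i))) \<in> mspace (layered A s M)" for i
    using dense_seq_in[OF e] c by auto
  fix p and \<epsilon> :: real assume p: "p \<in> mspace (layered A s M)" and \<epsilon>: "\<epsilon> > 0"
  obtain x a where xa: "p = (x, a)" "x \<in> mspace M" "a \<in> A"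
    using p by auto
  define r where "r = (if 0 < a then min \<epsilon> (\<delta> a) else \<epsilon>)"
  have "r > 0"
    using \<epsilon> \<delta>_pos xa by (auto simp: r_def)
  then obtain i where i: "mdist M x (e i) < r"
    using dense_seq_near[OF e xa(2)] by blast
  obtain j where j: "c j = a"
    using c xa by blast
  have "layer_dist s M (x, a) (e i, a) = mdist M x (e i)"
    using i by (intro layer_dist_close xa dense_seq_in[OF e]) (auto simp: r_def)
  moreover have "r \<le> \<epsilon>"
    by (simp add: r_def)
  ultimately show "\<exists>i. mdist (layered A s M) p (e (fst (prod_decode i)), c (snd (prod_decode i))) < \<epsilon>"
    using i j xa by (intro exI[of _ "prod_encode (i, j)"]) simp
qed

lemma mcomplete_layered:
  assumes M: "mcomplete_of M"
  shows "mcomplete_of (layered A s M)"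
  unfolding mcomplete_of_alt
proof (intro allI impI)
  fix p :: "nat \<Rightarrow> 'a \<times> real"
  assume p: "\<forall>n. p n \<in> mspace (layered A s M)"
    and C: "\<forall>\<epsilon>>0. \<exists>N. \<forall>n\<ge>N. \<forall>k\<ge>N. mdist (layered A s M) (p n) (p k) < \<epsilon>"
  define x where "x n = fst (p n)" for n
  define a where "a n = snd (p n)" for n
  have px: "p n = (x n, a n)" for n
    by (simp add: x_def a_def)
  have xM: "x n \<in> mspace M" and aA: "a n \<in> A" for n
    using p[rule_format, of n] by (auto simp: px)
  have C': "\<exists>N. \<forall>n\<ge>N. \<forall>k\<ge>N. layer_dist s M (x n, a n) (x k, a k) < \<epsilon>" if "\<epsilon> > 0" for \<epsilon>
    using C that by (auto simp: px)
  have "\<forall>\<epsilon>>0. \<exists>N. \<forall>n\<ge>N. \<forall>k\<ge>N. mdist M (x n) (x k) < \<epsilon>"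
  proof (intro allI impI)
    fix \<epsilon> :: real assume "\<epsilon> > 0"
    then obtain N where "\<forall>n\<ge>N. \<forall>k\<ge>N. layer_dist s M (x n, a n) (x k, a k) < \<epsilon>"
      using C' by blast
    then show "\<exists>N. \<forall>n\<ge>N. \<forall>k\<ge>N. mdist M (x n) (x k) < \<epsilon>"
      by (auto simp: layer_dist_def)
  qed
  then obtain y where y: "y \<in> mspace M" and lim: "\<forall>\<epsilon>>0. \<exists>N. \<forall>n\<ge>N. mdist M (x n) y < \<epsilon>"
    using mcomplete_ofD[OF M, of x] xM by blast
  show "\<exists>q\<in>mspace (layered A s M). \<forall>\<epsilon>>0. \<exists>N. \<forall>n\<ge>N. mdist (layered A s M) (p n) q < \<epsilon>"
  \<comment> \<open>Either the layers tend to \<open>0\<close> and the limit lies in layer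
    \<open>0\<close>, or layers above some positive bound recur, and then the layer is eventually
    constant.\<close>
  proof (cases "\<forall>\<epsilon>>0. \<exists>N. \<forall>n\<ge>N. a n < \<epsilon>")
    case True
    have "\<exists>N. \<forall>n\<ge>N. layer_dist s M (x n, a n) (y, 0) < \<epsilon>" if \<epsilon>: "\<epsilon> > 0" for \<epsilon>
    proof -
      obtain N N' where "\<forall>n\<ge>N. a n < \<epsilon>" "\<forall>n\<ge>N'. mdist M (x n) y < \<epsilon>"
        using True lim \<epsilon> by meson
      then have "\<forall>n\<ge>max N N'. layer_dist s M (x n, a n) (y, 0) < \<epsilon>"
        using \<epsilon> by (auto simp: layer_dist_def)
      then show ?thesis
        by blast
    qed
    then show ?thesis
      using y zero_A by (intro bexI[of _ "(y, 0)"]) (auto simp: px)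
  next
    case False
    then obtain \<epsilon> where \<epsilon>: "\<epsilon> > 0" "\<And>N. \<exists>n\<ge>N. \<epsilon> \<le> a n"
      by (meson not_less)
    obtain N where N: "\<And>n k. n \<ge> N \<Longrightarrow> k \<ge> N \<Longrightarrow> layer_dist s M (x n, a n) (x k, a k) < \<epsilon>"
      using C'[OF \<epsilon>(1)] by blast
    obtain n0 where n0: "n0 \<ge> N" "\<epsilon> \<le> a n0"
      using \<epsilon>(2) by blast
    define b where "b = a n0"
    have b: "b \<in> A" "0 < b"
      using aA n0 \<epsilon> by (auto simp: b_def)
    \<comment> \<open>A distance below \<open>\<epsilon> \<le> b\<close> leaves no room for the term
      \<open>max (snd p) (snd q)\<close>, so both points lie in layer \<open>b\<close>.\<close>
    have ab: "a n = b" if "n \<ge> N" for n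
      using N[OF n0(1) that] n0(2) by (auto simp: layer_dist_def b_def split: if_splits)
    have "\<exists>N. \<forall>n\<ge>N. layer_dist s M (x n, a n) (y, b) < \<epsilon>'" if \<epsilon>': "\<epsilon>' > 0" for \<epsilon>'
    proof -
      have "min \<epsilon>' (\<delta> b) > 0"
        using \<epsilon>' \<delta>_pos[OF b] by simp
      then obtain N' where N': "\<forall>n\<ge>N'. mdist M (x n) y < min \<epsilon>' (\<delta> b)"
        using lim by blast
      have "layer_dist s M (x n, a n) (y, b) < \<epsilon>'" if "n \<ge> max N N'" for n
      proof -
        have "layer_dist s M (x n, b) (y, b) = mdist M (x n) y"
          by (rule layer_dist_close) (use b xM y N' that in auto)
        then show ?thesis
          using ab[of n] N' that by simp
      qed
      then show ?thesis
        by blast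
    qed
    then show ?thesis
      using y b by (intro bexI[of _ "(y, b)"]) (auto simp: px)
  qed
qed

lemma layer_dist_in:
  assumes "p \<in> mspace M \<times> A" "q \<in> mspace M \<times> A"
  shows "layer_dist s M p q \<in> A"
proof -
  have "mdist M (fst p) (fst q) \<in> A"
    using subsetD[OF DM mdist_in_dist_values, of "fst p" "fst q"] assms B_sub by auto
  then show ?thesis
    using assms zero_A by (auto simp: layer_dist_def max_def)
qed

lemma layer_dist_0:
  assumes "x \<in> mspace M" "b \<in> A"
  shows "layer_dist s M (x, 0) (x, b) = b"
  using assms nonneg_A[of b]
  by (auto simp: layer_dist_def same_layer_ball_refl mdist_self)

lemma dist_values_layered:
  assumes "mspace M \<noteq> {}"
  shows "dist_values (layered A s M) = A"
proof
  show "dist_values (layered A s M) \<subseteq> A"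
    unfolding dist_values_def using layer_dist_in by auto
  obtain x where x: "x \<in> mspace M"
    using assms by blast
  show "A \<subseteq> dist_values (layered A s M)"
  proof
    fix b assume b: "b \<in> A"
    then show "b \<in> dist_values (layered A s M)"
      using layer_dist_0[OF x b] x zero_A mdist_in_dist_values[of "(x, 0)" "layered A s M" "(x, b)"] by simp
  qed
qed

text \<open>This will remove a maximum with \<open>m\<close> from the distances of distinct
  points.\<close>

lemma mdist_ge_lower_bound:
  assumes "x \<in> mspace M" "y \<in> mspace M" "x \<noteq> y" and m: "\<forall>b\<in>A. 0 < b \<longrightarrow> m \<le> b"
  shows "m \<le> mdist M x y"
proof -
  have "mdist M x y \<noteq> 0"
    using assms by simp
  then have "0 < mdist M x y"
    using mdist_nonneg[of M x y] by linarith
  moreover have "mdist M x y \<in> A"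
    using subsetD[OF DM mdist_in_dist_values[OF assms(1,2)]] B_sub by blast
  ultimately show ?thesis
    using m by blast
qed

text \<open>If \<open>A\<close> has a positive element below \<open>a\<close>, \<open>skip\<close>
  supplies a value \<open>b\<close>: leaving the layer or the class costs at least
  \<open>a > b\<close>, and staying there gives only distances of \<open>M\<close> up to
  \<open>s a\<close>, none equal to \<open>b\<close>. Otherwise \<open>a\<close> is \<open>0\<close>
  or the least positive element, and points over the same \<open>x\<close> realize
  everything.\<close>

lemma all_distances_iff:
  assumes x: "x \<in> mspace M" and a: "a \<in> A"
  shows "(\<forall>b\<in>A. \<exists>q\<in>mspace M \<times> A. layer_dist s M (x, a) q = b) \<longleftrightarrow> (\<forall>b\<in>A. 0 < b \<longrightarrow> a \<le> b)"
proof
  assume L: "\<forall>b\<in>A. \<exists>q\<in>mspace M \<times> A. layer_dist s M (x, a) q = b"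
  show "\<forall>b\<in>A. 0 < b \<longrightarrow> a \<le> b"
  proof (intro ballI impI, rule ccontr)
    fix b' assume "b' \<in> A" "0 < b'" "\<not> a \<le> b'"
    then obtain b where b: "b \<in> A" "0 < b" "b < a" "\<And>t. t \<in> B \<Longrightarrow> t \<le> s a \<Longrightarrow> t \<noteq> b"
      using skip[OF a, of b'] by (meson not_le)
    then obtain y c where y: "y \<in> mspace M" "c \<in> A" "layer_dist s M (x, a) (y, c) = b"
      using L by force
    show False
    proof (cases "a = c \<and> same_layer_ball s M a x y")
      case True
      then have "mdist M x y = b"
        using y b by (auto simp: layer_dist_def max_def split: if_splits)
      moreover have "mdist M x y \<le> s a"
        using same_layer_ball_dist[OF a _ x y(1)] True b by auto
      moreover have "mdist M x y \<in> B"
        by (rule subsetD[OF DM mdist_in_dist_values[OF x y(1)]])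
      ultimately show False
        using b by blast
    next
      case False
      then have "max a c \<le> layer_dist s M (x, a) (y, c)"
        by (auto simp: layer_dist_def)
      then show False
        using y b by simp
    qed
  qed
next
  assume R: "\<forall>b\<in>A. 0 < b \<longrightarrow> a \<le> b"
  show "\<forall>b\<in>A. \<exists>q\<in>mspace M \<times> A. layer_dist s M (x, a) q = b"
  proof
    fix b assume b: "b \<in> A"
    have xx: "mdist M x x = 0"
      using x by simp
    \<comment> \<open>The value \<open>b = a\<close> needs its own witness, because
      \<open>(x, a)\<close> is at distance \<open>0\<close> from itself; layer \<open>0\<close>
      provides it.\<close>
    consider "b = 0" | "0 < b" "a \<noteq> b" | "0 < b" "a = b"
      using nonneg_A[OF b] by fastforce
    then show "\<exists>q\<in>mspace M \<times> A. layer_dist s M (x, a) q = b"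
    proof cases
      case 1
      then show ?thesis
        using x a xx by (intro bexI[of _ "(x, a)"]) (auto simp: layer_dist_def same_layer_ball_refl)
    next
      case 2
      then show ?thesis
        using x b R nonneg_A[OF b] by (intro bexI[of _ "(x, b)"]) (auto simp: layer_dist_def mdist_self max_def)
    next
      case 3
      then show ?thesis
        using x zero_A by (intro bexI[of _ "(x, 0)"]) (auto simp: layer_dist_def mdist_self)
    qed
  qed
qed

end

section \<open>Isometry of layered spaces and isometry of their bases\<close>

lemma isometric_layered:
  assumes "isometric M N"
  shows "isometric (layered A s M) (layered A s N)"
proof -
  obtain f where f: "isometry M N f"
    using assms by (auto simp: isometric_def)
  note f1 = isometryD[OF f]
  have rel: "same_layer_ball s N a (f x) (f y) \<longleftrightarrow> same_layer_ball s M a x y"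
    if "x \<in> mspace M" "y \<in> mspace M" for a x y
    unfolding same_layer_ball_def
  proof (rule iffI; rule ballI)
    fix z assume "\<forall>z\<in>mspace N. (mdist N (f x) z \<le> s a) = (mdist N (f y) z \<le> s a)" "z \<in> mspace M"
    then show "(mdist M x z \<le> s a) = (mdist M y z \<le> s a)"
      using f1(1) f1(3) that by metis
  next
    fix z assume "\<forall>z\<in>mspace M. (mdist M x z \<le> s a) = (mdist M y z \<le> s a)" "z \<in> mspace N"
    then show "(mdist N (f x) z \<le> s a) = (mdist N (f y) z \<le> s a)"
      using f1(2)[of z] f1(3) that by metis
  qed
  have "isometry (layered A s M) (layered A s N) (\<lambda>(x, a). (f x, a))"
  proof (rule isometryI)
    show "(case p of (x, a) \<Rightarrow> (f x, a)) \<in> mspace (layered A s N)" if "p \<in> mspace (layered A s M)" for p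
      using that f1(1) by auto
    show "\<exists>p\<in>mspace (layered A s M). (case p of (x, a) \<Rightarrow> (f x, a)) = q"
      if q': "q \<in> mspace (layered A s N)" for q
    proof -
      obtain y a where q: "q = (y, a)" "y \<in> mspace N" "a \<in> A"
        using q' by auto
      then obtain x where "x \<in> mspace M" "f x = y"
        using f1(2) by blast
      then show ?thesis
        using q by (intro bexI[of _ "(x, a)"]) auto
    qed
    show "mdist (layered A s N) (case p of (x, a) \<Rightarrow> (f x, a)) (case q of (x, a) \<Rightarrow> (f x, a)) =
      mdist (layered A s M) p q"
      if "p \<in> mspace (layered A s M)" "q \<in> mspace (layered A s M)" for p q
      using that rel f1(3) by (auto simp: layer_dist_def split_beta)
  qed
  then show ?thesis
    by (auto simp: isometric_def)
qed

lemma isometric_of_layered: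
  fixes M :: "'a metric" and N :: "'b metric"
  assumes M: "dist_values M \<subseteq> B" and N: "dist_values N \<subseteq> B"
    and iso: "isometric (layered A s M) (layered A s N)"
  shows "isometric M N"
proof -
  obtain F where F: "isometry (layered A s M) (layered A s N) F"
    using iso by (auto simp: isometric_def)
  \<comment> \<open>The layers whose points realize all of \<open>A\<close>: layer \<open>0\<close>
    and, if it exists, the layer of the least positive element. Realizing all of \<open>A\<close> is
    invariant under isometries, so \<open>F\<close> maps \<open>mspace M \<times> K\<close> onto
    \<open>mspace N \<times> K\<close>.\<close>
  define K where "K = {a \<in> A. \<forall>b\<in>A. 0 < b \<longrightarrow> a \<le> b}"
  have K0: "0 \<in> K"
    using zero_A by (auto simp: K_def)
  have "a = a'" if "a \<in> K" "a' \<in> K" "0 < a" "0 < a'" for a a'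
    using that by (auto simp: K_def intro: antisym)
  then have "K \<subseteq> {0, SOME a. a \<in> K \<and> 0 < a}"
    using nonneg_A by (auto simp: K_def) (smt (verit) someI)
  then have fin: "finite K"
    by (rule finite_subset) simp
  \<comment> \<open>The least positive element of \<open>A\<close> if there is one, otherwise
    \<open>0\<close>. Between layers in \<open>K\<close> the added term is at most \<open>m\<close>,
    so a maximum with \<open>m\<close> hides it.\<close>
  define m where "m = Max K"
  have mK: "m \<in> K" and Km: "\<And>a. a \<in> K \<Longrightarrow> a \<le> m"
    using fin K0 Max_in[OF fin] Max_ge[OF fin] by (auto simp only: m_def)
  have lower: "\<forall>b\<in>A. 0 < b \<longrightarrow> m \<le> b"
    using mK by (simp add: K_def)
  have coreM: "(\<forall>b\<in>A. \<exists>q\<in>mspace M \<times> A. layer_dist s M p q = b) \<longleftrightarrow> snd p \<in> K"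
    if "p \<in> mspace M \<times> A" for p
    using that all_distances_iff[OF M, of "fst p" "snd p"] by (auto simp: K_def)
  have coreN: "(\<forall>b\<in>A. \<exists>q\<in>mspace N \<times> A. layer_dist s N p q = b) \<longleftrightarrow> snd p \<in> K"
    if "p \<in> mspace N \<times> A" for p
    using that all_distances_iff[OF N, of "fst p" "snd p"] by (auto simp: K_def)
  have F1: "F p \<in> mspace N \<times> A" if "p \<in> mspace M \<times> A" for p
    using isometryD(1)[OF F, of p] that by simp
  have F2: "\<exists>p\<in>mspace M \<times> A. F p = q" if "q \<in> mspace N \<times> A" for q
    using isometryD(2)[OF F, of q] that by simp
  have F3: "layer_dist s N (F p) (F q) = layer_dist s M p q"
    if "p \<in> mspace M \<times> A" "q \<in> mspace M \<times> A" for p q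
    using isometryD(3)[OF F, of p q] that by simp
  have K_iff: "snd (F p) \<in> K \<longleftrightarrow> snd p \<in> K" if p: "p \<in> mspace M \<times> A" for p
  proof -
    have "(\<exists>q\<in>mspace N \<times> A. layer_dist s N (F p) q = b) \<longleftrightarrow>
      (\<exists>q\<in>mspace M \<times> A. layer_dist s M p q = b)" for b
      using F1 F2 F3[OF p] by metis
    then show ?thesis
      using coreM[OF p] coreN[OF F1[OF p]] by simp
  qed
  have KA: "K \<subseteq> A"
    by (auto simp: K_def)
  have "inj_on F (mspace M \<times> K)"
    using isometry_bij_betw[OF F] KA by (auto simp: bij_betw_def intro: inj_on_subset)
  moreover have "F ` (mspace M \<times> K) = mspace N \<times> K"
  proof (intro equalityI subsetI)
    fix q assume "q \<in> F ` (mspace M \<times> K)"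
    then obtain p where p: "p \<in> mspace M \<times> A" "snd p \<in> K" "q = F p"
      using KA by auto
    then show "q \<in> mspace N \<times> K"
      using F1[OF p(1)] K_iff[OF p(1)] by (simp add: mem_Times_iff)
  next
    fix q assume q: "q \<in> mspace N \<times> K"
    then obtain p where p: "p \<in> mspace M \<times> A" "F p = q"
      using F2[of q] KA by auto
    then have "p \<in> mspace M \<times> K"
      using q K_iff[OF p(1)] by (simp add: mem_Times_iff)
    then show "q \<in> F ` (mspace M \<times> K)"
      using p by blast
  qed
  ultimately have bij: "bij_betw F (mspace M \<times> K) (mspace N \<times> K)"
    by (simp add: bij_betw_def)
  have K_bounds: "0 \<le> a" "a \<le> m" if "a \<in> K" for a
    using that Km nonneg_A KA by auto
  have maxM: "max (layer_dist s M p q) m = max (mdist M (fst p) (fst q)) m"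
    if "snd p \<in> K" "snd q \<in> K" for p q
    using K_bounds[OF that(1)] K_bounds[OF that(2)] by (auto simp: layer_dist_def)
  have maxN: "max (layer_dist s N p q) m = max (mdist N (fst p) (fst q)) m"
    if "snd p \<in> K" "snd q \<in> K" for p q
    using K_bounds[OF that(1)] K_bounds[OF that(2)] by (auto simp: layer_dist_def)
  have pres: "max (mdist N (fst (F p)) (fst (F q))) m = max (mdist M (fst p) (fst q)) m"
    if p: "p \<in> mspace M \<times> K" and q: "q \<in> mspace M \<times> K" for p q
  proof -
    have A: "p \<in> mspace M \<times> A" "q \<in> mspace M \<times> A"
      using p q KA by auto
    have "snd p \<in> K" "snd q \<in> K"
      using p q by auto
    then show ?thesis
      using maxM[of p q] maxN[of "F p" "F q"] K_iff A F3[OF A] by simp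
  qed
  \<comment> \<open>\<open>F\<close> may mix the layers and so need not induce a map of the bases.
    Up to maxima with \<open>m\<close> it preserves the distances of first coordinates, and counting
    copies yields a bijection \<open>h\<close> doing the same.\<close>
  obtain h where h: "bij_betw h (mspace M) (mspace N)"
    and hd: "\<And>x x'. x \<in> mspace M \<Longrightarrow> x' \<in> mspace M \<Longrightarrow>
      max (mdist N (h x) (h x')) m = max (mdist M x x') m"
    using bij_of_multiple_copies[OF fin K0 bij,
        of "\<lambda>y y'. max (mdist N y y') m" "\<lambda>x x'. max (mdist M x x') m"] pres
    by (auto simp: mdist_commute)
  have "isometry M N h"
  proof (rule isometryI)
    show hN: "h x \<in> mspace N" if "x \<in> mspace M" for x
      using h that by (meson bij_betwE)
    show "\<exists>x\<in>mspace M. h x = y" if "y \<in> mspace N" for y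
      using h that by (metis bij_betw_imp_surj_on imageE)
    show "mdist N (h x) (h y) = mdist M x y" if x: "x \<in> mspace M" "y \<in> mspace M" for x y
    \<comment> \<open>Distinct points are at distance at least \<open>m\<close>, so for them the
      maximum changes nothing.\<close>
    proof (cases "x = y")
      case True
      then show ?thesis
        using x hN by (simp add: mdist_self)
    next
      case False
      then have "h x \<noteq> h y"
        using h x by (auto simp: bij_betw_def inj_on_def)
      then have "m \<le> mdist N (h x) (h y)"
        by (intro mdist_ge_lower_bound[OF N] hN x lower)
      moreover have "m \<le> mdist M x y"
        by (rule mdist_ge_lower_bound[OF M x False lower])
      ultimately show ?thesis
        using hd[OF x] by (simp add: max_def split: if_splits)
    qed
  qed
  then show ?thesis
    by (auto simp: isometric_def)
qed

end

section \<open>Rescaled spaces\<close>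

definition rescaled :: "(real \<Rightarrow> real) \<Rightarrow> 'a metric \<Rightarrow> 'a metric" where
  "rescaled f M = metric (mspace M, \<lambda>x y. f (mdist M x y))"

text \<open>\<open>f_triangle\<close> contains monotonicity (\<open>b = 0\<close>) as well as
  subadditivity. \<open>f_small\<close> and \<open>f_small_imp\<close> make the old and the new
  metric uniformly equivalent, which preserves density and completeness.\<close>

locale rescaling =
  fixes A :: "real set" and f :: "real \<Rightarrow> real"
  assumes zero_in: "0 \<in> A" and f_nonneg: "0 \<le> f t" and f_0: "f 0 = 0" and f_inj: "inj_on f A"
    and f_triangle: "a \<in> A \<Longrightarrow> b \<in> A \<Longrightarrow> c \<in> A \<Longrightarrow> c \<le> a + b \<Longrightarrow> f c \<le> f a + f b"
    and f_small: "\<epsilon> > 0 \<Longrightarrow> \<exists>\<delta>>0. \<forall>a\<in>A. a < \<delta> \<longrightarrow> f a < \<epsilon>"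
    and f_small_imp: "\<epsilon> > 0 \<Longrightarrow> \<exists>\<delta>>0. \<forall>a\<in>A. f a < \<delta> \<longrightarrow> a < \<epsilon>"
begin

context
  fixes M :: "'a metric"
  assumes DM: "dist_values M \<subseteq> A"
begin

lemma mdist_in_A: "x \<in> mspace M \<Longrightarrow> y \<in> mspace M \<Longrightarrow> mdist M x y \<in> A"
  using subsetD[OF DM mdist_in_dist_values] .

lemma rescaled_metric: "Metric_space (mspace M) (\<lambda>x y. f (mdist M x y))"
proof
  show "f (mdist M x y) = 0 \<longleftrightarrow> x = y" if "x \<in> mspace M" "y \<in> mspace M" for x y
    using inj_onD[OF f_inj, of "mdist M x y" 0] mdist_in_A[OF that] zero_in f_0 mdist_zero[OF that]
    by auto
  show "f (mdist M x z) \<le> f (mdist M x y) + f (mdist M y z)"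
    if "x \<in> mspace M" "y \<in> mspace M" "z \<in> mspace M" for x y z
    using that by (intro f_triangle mdist_in_A mdist_triangle)
qed (auto simp: f_nonneg mdist_commute)

lemma mspace_rescaled: "mspace (rescaled f M) = mspace M"
  by (simp add: rescaled_def Metric_space.mspace_metric[OF rescaled_metric])

lemma mdist_rescaled: "mdist (rescaled f M) = (\<lambda>x y. f (mdist M x y))"
  by (simp add: rescaled_def Metric_space.mdist_metric[OF rescaled_metric])

lemma dist_values_rescaled: "dist_values (rescaled f M) \<subseteq> f ` A"
  using mdist_in_A by (auto simp: dist_values_def mspace_rescaled mdist_rescaled)

lemma dense_seq_rescaled:
  assumes "dense_seq M e"
  shows "dense_seq (rescaled f M) e"
  unfolding dense_seq_def mspace_rescaled mdist_rescaled
proof (intro conjI allI ballI impI)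
  show "e i \<in> mspace M" for i
    by (rule dense_seq_in[OF assms])
  fix x and \<epsilon> :: real assume x: "x \<in> mspace M" and "\<epsilon> > 0"
  then obtain \<delta> where "\<delta> > 0" "\<forall>a\<in>A. a < \<delta> \<longrightarrow> f a < \<epsilon>"
    using f_small by blast
  moreover from this obtain i where "mdist M x (e i) < \<delta>"
    using dense_seq_near[OF assms x] by blast
  ultimately show "\<exists>i. f (mdist M x (e i)) < \<epsilon>"
    using mdist_in_A[OF x dense_seq_in[OF assms]] by blast
qed

lemma mcomplete_rescaled:
  assumes M: "mcomplete_of M"
  shows "mcomplete_of (rescaled f M)"
  unfolding mcomplete_of_alt mspace_rescaled mdist_rescaled
proof (intro allI impI)
  fix x :: "nat \<Rightarrow> 'a"
  assume x: "\<forall>n. x n \<in> mspace M" and C: "\<forall>\<epsilon>>0. \<exists>N. \<forall>n\<ge>N. \<forall>k\<ge>N. f (mdist M (x n) (x k)) < \<epsilon>"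
  have "\<forall>\<epsilon>>0. \<exists>N. \<forall>n\<ge>N. \<forall>k\<ge>N. mdist M (x n) (x k) < \<epsilon>"
  proof (intro allI impI)
    fix \<epsilon> :: real assume "\<epsilon> > 0"
    then obtain \<delta> where "\<delta> > 0" and \<delta>: "\<forall>a\<in>A. f a < \<delta> \<longrightarrow> a < \<epsilon>"
      using f_small_imp by blast
    then obtain N where "\<forall>n\<ge>N. \<forall>k\<ge>N. f (mdist M (x n) (x k)) < \<delta>"
      using C by blast
    then show "\<exists>N. \<forall>n\<ge>N. \<forall>k\<ge>N. mdist M (x n) (x k) < \<epsilon>"
      using \<delta> mdist_in_A x by blast
  qed
  then obtain y where y: "y \<in> mspace M" and lim: "\<forall>\<epsilon>>0. \<exists>N. \<forall>n\<ge>N. mdist M (x n) y < \<epsilon>"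
    using mcomplete_ofD[OF M, of x] x by blast
  have "\<exists>N. \<forall>n\<ge>N. f (mdist M (x n) y) < \<epsilon>" if "\<epsilon> > 0" for \<epsilon>
  proof -
    obtain \<delta> where "\<delta> > 0" and \<delta>: "\<forall>a\<in>A. a < \<delta> \<longrightarrow> f a < \<epsilon>"
      using f_small \<open>\<epsilon> > 0\<close> by blast
    then obtain N where "\<forall>n\<ge>N. mdist M (x n) y < \<delta>"
      using lim by blast
    then show ?thesis
      using \<delta> mdist_in_A x y by blast
  qed
  then show "\<exists>y\<in>mspace M. \<forall>\<epsilon>>0. \<exists>N. \<forall>n\<ge>N. f (mdist M (x n) y) < \<epsilon>"
    using y by blast
qed

end

text \<open>As \<open>f\<close> is injective on the distances involved, the very same maps are
  isometries before and after rescaling.\<close>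

lemma isometry_rescaled_iff:
  assumes M: "dist_values M \<subseteq> A" and N: "dist_values N \<subseteq> A"
  shows "isometric (rescaled f M) (rescaled f N) \<longleftrightarrow> isometric M N"
proof -
  have "isometry (rescaled f M) (rescaled f N) h \<longleftrightarrow> isometry M N h" for h
  proof -
    have "f (mdist N (h x) (h y)) = f (mdist M x y) \<longleftrightarrow> mdist N (h x) (h y) = mdist M x y"
      if "x \<in> mspace M" "y \<in> mspace M" "h ` mspace M \<subseteq> mspace N" for x y
      using inj_onD[OF f_inj] mdist_in_A[OF M] mdist_in_A[OF N] that by (metis image_subset_iff)
    then show ?thesis
      unfolding isometry_def isometric_embedding_def mspace_rescaled[OF M] mspace_rescaled[OF N]
        mdist_rescaled[OF M] mdist_rescaled[OF N]
      by blast
  qed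
  then show ?thesis
    by (simp add: isometric_def)
qed

end

section \<open>Rescaling when \<open>A\<close> leaves gaps arbitrarily near zero\<close>

lemma gaps_near_zero_rescaling:
  assumes "0 \<in> A" and nonneg: "\<And>a. a \<in> A \<Longrightarrow> 0 \<le> a"
    and not_dense: "\<And>r. r > 0 \<Longrightarrow> \<exists>x y. 0 \<le> x \<and> x < y \<and> y \<le> r \<and> (\<forall>t\<in>A. \<not> (x < t \<and> t < y))"
  shows "\<exists>f s \<delta>. rescaling A f \<and> layering A (f ` A) s \<delta>"
proof -
  \<comment> \<open>\<open>x\<close> and \<open>y\<close> bound a gap of \<open>A\<close>, chosen
    below some positive \<open>b < a\<close> of \<open>A\<close> if there is one. They become
    \<open>s a\<close> and \<open>s a + \<delta> a\<close>; as \<open>b\<close> exceeds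
    \<open>s a\<close>, it is the skipped value.\<close>
  define Q where "Q a x y \<longleftrightarrow> 0 \<le> x \<and> x < y \<and> (\<forall>t\<in>A. \<not> (x < t \<and> t < y)) \<and>
      ((\<exists>b\<in>A. 0 < b \<and> b < a) \<longrightarrow> (\<exists>b\<in>A. 0 < b \<and> b < a \<and> y \<le> b))" for a x y
  have "\<exists>x y. Q a x y" if a: "a > 0" for a
  proof (cases "\<exists>b\<in>A. 0 < b \<and> b < a")
    case True
    then obtain b where b: "b \<in> A" "0 < b" "b < a"
      by blast
    obtain x y where xy: "0 \<le> x" "x < y" "y \<le> b" "\<forall>t\<in>A. \<not> (x < t \<and> t < y)"
      using not_dense[OF b(2)] by metis
    have "\<exists>b\<in>A. 0 < b \<and> b < a \<and> y \<le> b"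
      using b xy(3) by blast
    then show ?thesis
      using xy unfolding Q_def by - (rule exI[of _ x], rule exI[of _ y], auto)
  next
    case False
    moreover obtain x y where "0 \<le> x" "x < y" "\<forall>t\<in>A. \<not> (x < t \<and> t < y)"
      using not_dense[OF a] by metis
    ultimately show ?thesis
      unfolding Q_def by - (rule exI[of _ x], rule exI[of _ y], auto)
  qed
  then obtain s u where "\<And>a. a > 0 \<Longrightarrow> Q a (s a) (u a)"
    by metis
  then have su: "0 \<le> s a \<and> s a < u a \<and> (\<forall>t\<in>A. \<not> (s a < t \<and> t < u a)) \<and>
      ((\<exists>b\<in>A. 0 < b \<and> b < a) \<longrightarrow> (\<exists>b\<in>A. 0 < b \<and> b < a \<and> u a \<le> b))" if "a > 0" for a
    using that by (simp add: Q_def)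
  \<comment> \<open>On \<open>A\<close> this is the identity; the maximum makes \<open>f\<close>
    nonnegative on all reals.\<close>
  define f :: "real \<Rightarrow> real" where "f t = max 0 t" for t
  have f: "f t = t" if "t \<in> A" for t
    using nonneg[OF that] by (simp add: f_def)
  have fA: "f ` A = A"
    using f by simp
  have "rescaling A f"
  proof
    show "inj_on f A"
      using f by (auto simp: inj_on_def)
    show "\<exists>\<delta>>0. \<forall>a\<in>A. a < \<delta> \<longrightarrow> f a < \<epsilon>" "\<exists>\<delta>>0. \<forall>a\<in>A. f a < \<delta> \<longrightarrow> a < \<epsilon>" if "\<epsilon> > 0" for \<epsilon>
      using that f by auto
  qed (use assms(1) f in \<open>auto simp: f_def\<close>)
  moreover have "layering A A s (\<lambda>a. u a - s a)"
  proof
    show "t \<le> s a \<or> s a + (u a - s a) \<le> t" if "a \<in> A" "0 < a" "t \<in> A" for a t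
      using su[OF that(2)] that(3) by force
    show "\<exists>b\<in>A. 0 < b \<and> b < a \<and> (\<forall>t\<in>A. t \<le> s a \<longrightarrow> t \<noteq> b)"
      if "a \<in> A" "b' \<in> A" "0 < b'" "b' < a" for a b'
    proof -
      have "a > 0"
        using that by linarith
      note su_a = su[OF this]
      have "\<exists>b\<in>A. 0 < b \<and> b < a"
        using that(2-4) by blast
      then obtain b where b: "b \<in> A" "0 < b" "b < a" "u a \<le> b"
        using su_a by blast
      then have "\<forall>t\<in>A. t \<le> s a \<longrightarrow> t \<noteq> b"
        using su_a by auto
      then show ?thesis
        using b by blast
    qed
  qed (use assms su in auto)
  ultimately show ?thesis
    using fA by metis
qed

section \<open>Rescaling when \<open>A\<close> is dense near zero\<close>

text \<open>The new value \<open>w\<close> at \<open>x\<close> has to keep both \<open>f\<close> strictly increasing and \<open>f t / t\<close> strictly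
  decreasing. An old value \<open>p\<close> at \<open>a\<close> confines \<open>w\<close> to the interval between \<open>p\<close> and \<open>p * x / a\<close>;
  these intervals overlap.\<close>

definition star_compatible :: "real \<Rightarrow> real \<Rightarrow> real \<Rightarrow> real \<Rightarrow> bool" where
  "star_compatible a p b q \<longleftrightarrow>
     (a < b \<longrightarrow> p < q \<and> q * a < p * b) \<and> (b < a \<longrightarrow> q < p \<and> p * b < q * a)"

lemma star_compatibleI:
  assumes "0 < a" "min p (p * x / a) < w" "w < max p (p * x / a)" "0 < p"
  shows "star_compatible a p x w"
proof -
  have "p < p * x / a \<longleftrightarrow> a < x" "p * x / a < p \<longleftrightarrow> x < a"
    using assms by (auto simp: field_simps)
  then show ?thesis
    using assms by (auto simp: star_compatible_def field_simps min_def max_def split: if_splits)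
qed

text \<open>Were this false, then \<open>q \<le> p\<close> and \<open>q / b \<le> p / a\<close>.
  Compatibility excludes the first if \<open>a < b\<close> and the second if \<open>b < a\<close>.
  For \<open>a = b\<close> the two intervals coincide and are nondegenerate because
  \<open>x \<noteq> a\<close>.\<close>

lemma star_compatible_intervals:
  assumes pos: "0 < a" "0 < b" "0 < p" "0 < q" "0 < x" and ne: "x \<noteq> a"
    and c: "star_compatible a p b q" "a = b \<Longrightarrow> p = q"
  shows "min p (p * x / a) < max q (q * x / b)"
proof (rule ccontr)
  assume "\<not> ?thesis"
  then have 1: "q \<le> p" "q * x / b \<le> p" "q \<le> p * x / a" "q * x / b \<le> p * x / a"
    by auto
  have "q * x * a \<le> p * x * b"
    using 1(4) pos by (simp add: field_simps)
  then have "(q * a) * x \<le> (p * b) * x"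
    by (simp add: mult_ac)
  then have 2: "q * a \<le> p * b"
    using pos by simp
  consider "a < b" | "b < a" | "a = b"
    by linarith
  then show False
  proof cases
    case 3
    then have "a \<le> x" "x \<le> a"
      using 1 c pos by (auto simp: field_simps)
    then show False
      using ne by simp
  qed (use 1 2 c in \<open>auto simp: star_compatible_def\<close>)
qed

text \<open>Values are chosen one by one. Each earlier value leaves an open interval for the new
  one; finitely many pairwise overlapping intervals have a common subinterval, and \<open>T\<close>
  has a point there.\<close>

lemma star_compatible_sequence:
  fixes c :: "nat \<Rightarrow> real" and T :: "real set"
  assumes c: "\<And>n. 0 < c n" "inj c" and r: "0 < r"
    and T: "\<And>x y. 0 \<le> x \<Longrightarrow> x < y \<Longrightarrow> y \<le> r \<Longrightarrow> \<exists>t\<in>T. x < t \<and> t < y"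
  shows "\<exists>v. \<forall>n. v n \<in> T \<and> 0 < v n \<and> v n < r * c n / (1 + c n) \<and>
     (\<forall>i<n. star_compatible (c i) (v i) (c n) (v n))"
proof -
  \<comment> \<open>\<open>g\<close> is strictly increasing, \<open>g t / t\<close> is strictly
    decreasing, and \<open>g\<close> stays below \<open>r\<close>. Hence the bound
    \<open>g (c n)\<close> always exceeds the lower ends left by earlier values, which lie below
    \<open>g\<close> themselves.\<close>
  define g where "g t = r * t / (1 + t)" for t
  have g_mono: "g a < g b" and g_ratio: "g b * a < g a * b" if "0 < a" "a < b" for a b
    using that r by (auto simp: g_def field_simps)
  have g_pos: "0 < g a" and g_less: "g a < r" if "0 < a" for a
    using that r by (auto simp: g_def field_simps)
  have sym: "star_compatible a p b q \<longleftrightarrow> star_compatible b q a p" for a p b q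
    by (auto simp: star_compatible_def)
  have refl: "star_compatible a p a p" for a p
    by (simp add: star_compatible_def)
  define P where "P v n w \<longleftrightarrow> w \<in> T \<and> 0 < w \<and> w < g (c n) \<and>
     (\<forall>i<n. star_compatible (c i) (v i) (c n) w)" for v :: "nat \<Rightarrow> real" and n w
  have "\<exists>v. \<forall>n. P v n (v n)"
  proof (rule dependent_wellorder_choice)
    show "P v n w = P v' n w" if "\<And>i. i < n \<Longrightarrow> v i = v' i" for w v v' n
      using that by (simp add: P_def)
    fix n v assume IH: "\<And>i. i < n \<Longrightarrow> P v i (v i)"
    let ?x = "c n"
    define lo where "lo i = min (v i) (v i * ?x / c i)" for i
    define up where "up i = max (v i) (v i * ?x / c i)" for i
    let ?L = "insert 0 (lo ` {..<n})"
    let ?U = "insert (g ?x) (up ` {..<n})"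
    have v: "0 < v i" "v i < g (c i)" if "i < n" for i
      using IH[OF that] by (auto simp: P_def)
    have vv: "star_compatible (c i) (v i) (c j) (v j)" if "i < n" "j < n" for i j
    proof (cases i j rule: linorder_cases)
      case less
      then show ?thesis
        using IH[OF that(2)] by (simp add: P_def)
    next
      case equal
      then show ?thesis
        by (simp add: refl)
    next
      case greater
      then show ?thesis
        using IH[OF that(1)] sym[of "c i"] by (simp add: P_def)
    qed
    have ne: "?x \<noteq> c i" if "i < n" for i
      using c(2) that by (auto simp: inj_def)
    have low_g: "lo i < g ?x" if i: "i < n" for i
    proof (cases "c i < ?x")
      case True
      then show ?thesis
        using v[OF i] g_mono[OF c(1) True] by (simp add: lo_def min_less_iff_disj)
    next
      case False
      then have lt: "?x < c i"
        using ne[OF i] by linarith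
      have "v i * ?x < g (c i) * ?x"
        using v(2)[OF i] c(1)[of n] by simp
      also have "\<dots> < g ?x * c i"
        by (rule g_ratio[OF c(1) lt])
      finally have "v i * ?x / c i < g ?x"
        using c(1)[of i] by (simp add: field_simps)
      then show ?thesis
        by (simp add: lo_def min_less_iff_disj)
    qed
    have low_up: "lo i < up j" if "i < n" "j < n" for i j
      unfolding lo_def up_def
      using star_compatible_intervals[OF c(1) c(1) v(1)[OF that(1)] v(1)[OF that(2)] c(1)
          ne[OF that(1)] vv[OF that]] injD[OF c(2)] by blast
    have up_pos: "0 < up j" if "j < n" for j
      using v(1)[OF that] by (simp add: up_def less_max_iff_disj)
    have "l < u" if "l \<in> ?L" "u \<in> ?U" for l u
      using that low_g low_up up_pos g_pos[OF c(1)[of n]] by auto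
    then have "Max ?L < Min ?U"
      by (simp add: Max_less_iff)
    moreover have "0 \<le> Max ?L"
      by (intro Max_ge) auto
    moreover have "Min ?U \<le> g ?x"
      by (intro Min_le) auto
    then have "Min ?U \<le> r"
      using g_less[OF c(1)[of n]] by linarith
    ultimately obtain w where w: "w \<in> T" "Max ?L < w" "w < Min ?U"
      using T by blast
    then have "0 < w" "w < g ?x" "\<And>i. i < n \<Longrightarrow> lo i < w" "\<And>i. i < n \<Longrightarrow> w < up i"
      by auto
    then have "P v n w"
      unfolding P_def using w(1) star_compatibleI[OF c(1)] v(1) by (simp add: lo_def up_def)
    then show "\<exists>w. P v n w" ..
  qed
  then show ?thesis
    by (simp add: P_def g_def)
qed

lemma dense_near_zero_rescaling:
  assumes A: "countable A" "0 \<in> A" and nonneg: "\<And>a. a \<in> A \<Longrightarrow> 0 \<le> a" and r: "r > 0"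
    and dense: "\<And>x y. 0 \<le> x \<Longrightarrow> x < y \<Longrightarrow> y \<le> r \<Longrightarrow> \<exists>t\<in>A. x < t \<and> t < y"
  shows "\<exists>f s \<delta>. rescaling A f \<and> layering A (f ` A) s \<delta>"
proof -
  have near0: "\<exists>t\<in>A. 0 < t \<and> t < \<epsilon>" if "\<epsilon> > 0" for \<epsilon>
    using dense[of 0 "min r \<epsilon>"] r that by auto
  then have "\<forall>n. \<exists>t\<in>A. 0 < t \<and> t < inverse (real (Suc n))"
    by simp
  then obtain R where R: "\<And>n. R n \<in> A" "\<And>n. 0 < R n" "\<And>n. R n < inverse (real (Suc n))"
    by metis
  define T where "T = A - range R"
  have T: "\<exists>t\<in>T. x < t \<and> t < y" if xy: "0 \<le> x" "x < y" "y \<le> r" for x y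
  proof -
    \<comment> \<open>Since \<open>x' > 0\<close>, only finitely many \<open>R n\<close> are at
      least \<open>x'\<close>. An element of \<open>A\<close> between \<open>Max S\<close> and
      \<open>y\<close> avoids them and exceeds \<open>x\<close>, so \<open>T\<close> is still dense
      near zero.\<close>
    define x' where "x' = max x (y / 2)"
    have x': "0 < x'" "x' < y" "x \<le> x'"
      using xy by (auto simp: x'_def)
    obtain N where N: "inverse (real (Suc N)) < x'"
      using reals_Archimedean[OF x'(1)] by blast
    have large: "n < N" if "x' \<le> R n" for n
    proof (rule ccontr)
      assume "\<not> n < N"
      then have "inverse (real (Suc n)) \<le> inverse (real (Suc N))"
        by (intro le_imp_inverse_le) auto
      then show False
        using R(3)[of n] N that by linarith
    qed
    define S where "S = insert x' {t \<in> R ` {..<N}. t < y}"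
    have S: "finite S" "S \<noteq> {}" "\<forall>t\<in>S. t < y"
      using x' by (auto simp: S_def)
    then have "Max S < y"
      by simp
    moreover have x'S: "x' \<le> Max S"
      by (rule Max_ge[OF S(1)]) (simp add: S_def)
    ultimately obtain t where t: "t \<in> A" "Max S < t" "t < y"
      using dense[of "Max S" y] x' xy by force
    have "t \<notin> range R"
    proof
      assume "t \<in> range R"
      then obtain n where "t = R n"
        by blast
      then have "t \<in> S"
        using large[of n] t x'S by (auto simp: S_def)
      then show False
        using t S by (meson Max_ge leD)
    qed
    then show ?thesis
      using t x'S x' by (intro bexI[of _ t]) (auto simp: T_def)
  qed
  define A' where "A' = {a \<in> A. 0 < a}"
  have "infinite A'"
  proof
    assume fin: "finite A'"
    obtain t where "t \<in> A" "0 < t"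
      using near0[of 1] by auto
    then have "A' \<noteq> {}"
      by (auto simp: A'_def)
    then have "Min A' \<in> A'"
      using fin by simp
    then obtain t where "t \<in> A" "0 < t" "t < Min A'"
      using near0[of "Min A'"] by (auto simp: A'_def)
    then show False
      using Min_le[OF fin, of t] by (simp add: A'_def)
  qed
  moreover have "countable A'"
    using A by (auto simp: A'_def)
  ultimately have bij: "bij_betw (from_nat_into A') UNIV A'"
    using bij_betw_from_nat_into by blast
  define c where "c = from_nat_into A'"
  have cA: "c n \<in> A'" for n
    using bij by (auto simp: c_def bij_betw_def)
  then have c: "0 < c n" "inj c" for n
    using bij by (auto simp: c_def bij_betw_def A'_def)
  obtain v where v: "\<And>n. v n \<in> T \<and> 0 < v n \<and> v n < r * c n / (1 + c n)"
    and vi: "\<And>i n. i < n \<Longrightarrow> star_compatible (c i) (v i) (c n) (v n)"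
    using star_compatible_sequence[of c r T, OF c r T] by auto
  \<comment> \<open>The value \<open>0\<close> outside the positive part of \<open>A\<close> gives
    \<open>f 0 = 0\<close> and nonnegativity everywhere.\<close>
  define f where "f t = (if t \<in> A' then v (inv_into UNIV c t) else 0)" for t
  have fc: "f (c n) = v n" for n
    using cA[of n] c(2) by (simp add: f_def)
  have ex: "\<exists>n. c n = a" if "a \<in> A'" for a
    using bij that unfolding c_def bij_betw_def by (metis imageE)
  have f: "f a \<in> T" "0 < f a" "f a < r * a / (1 + a)" if "a \<in> A'" for a
    using ex[OF that] fc v by auto
  have comp: "star_compatible a (f a) b (f b)" if ab: "a \<in> A'" "b \<in> A'" for a b
  proof -
    obtain m n where "c m = a" "c n = b"
      using ex ab by blast
    then show ?thesis
      using vi[of m n] vi[of n m] fc[of m] fc[of n]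
      by (cases m n rule: linorder_cases) (auto simp: star_compatible_def)
  qed
  have f0: "f t = 0" if "t \<notin> A'" for t
    using that by (simp add: f_def)
  have A_cases: "a = 0 \<or> a \<in> A'" if "a \<in> A" for a
    using nonneg[OF that] that by (auto simp: A'_def)
  have f_nonneg: "0 \<le> f t" for t
    using f0[of t] f(2)[of t] by (cases "t \<in> A'") auto
  have z: "f 0 = 0"
    by (rule f0) (simp add: A'_def)
  have mono: "f a < f b" if "a \<in> A" "b \<in> A" "a < b" for a b
  proof -
    have "b \<in> A'"
      using that nonneg[of a] by (auto simp: A'_def)
    then show ?thesis
      using A_cases[OF that(1)] z f(2)[of b] comp[of a b] that(3) by (auto simp: star_compatible_def)
  qed
  have lt_r: "f a < r" if "a \<in> A" for a
  proof -
    have "r * a / (1 + a) < r" if "0 < a"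
      using that r by (simp add: field_simps)
    then show ?thesis
      using A_cases[OF that] z r f(3)[of a] by (auto simp: A'_def)
  qed
  have resc: "rescaling A f"
  proof
    show "0 \<in> A" "0 \<le> f t" "f 0 = 0" for t
      by (fact A(2) f_nonneg z)+
    show "inj_on f A"
    proof (rule inj_onI)
      fix a b assume "a \<in> A" "b \<in> A" "f a = f b"
      then show "a = b"
        using mono[of a b] mono[of b a] by (cases a b rule: linorder_cases) auto
    qed
    \<comment> \<open>The bound \<open>r * a / (1 + a)\<close> is at most \<open>r * a\<close>,
      hence the threshold \<open>\<epsilon> / r\<close>.\<close>
    show "\<exists>\<delta>>0. \<forall>a\<in>A. a < \<delta> \<longrightarrow> f a < \<epsilon>" if \<epsilon>: "\<epsilon> > 0" for \<epsilon>
    proof (intro exI[of _ "\<epsilon> / r"] conjI ballI impI)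
      show "0 < \<epsilon> / r"
        using \<epsilon> r by simp
      fix a assume a: "a \<in> A" "a < \<epsilon> / r"
      have "r * a / (1 + a) \<le> r * a" if "0 < a"
        using that r by (simp add: field_simps)
      moreover have "r * a < \<epsilon>"
        using a r by (simp add: field_simps)
      ultimately show "f a < \<epsilon>"
        using A_cases[OF a(1)] z \<epsilon> f(3)[of a] by (auto simp: A'_def)
    qed
    show "\<exists>\<delta>>0. \<forall>a\<in>A. f a < \<delta> \<longrightarrow> a < \<epsilon>" if \<epsilon>: "\<epsilon> > 0" for \<epsilon>
    proof -
      \<comment> \<open>\<open>f t\<close> serves as the threshold, because \<open>f\<close> is
        strictly increasing on \<open>A\<close>.\<close>
      obtain t where t: "t \<in> A" "0 < t" "t < \<epsilon>"
        using near0[OF \<epsilon>] by blast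
      have "a < \<epsilon>" if "a \<in> A" "f a < f t" for a
        using mono[OF t(1) that(1)] that(2) t(3) by (cases a t rule: linorder_cases) auto
      moreover have "0 < f t"
        using mono[OF A(2) t(1) t(2)] z by simp
      ultimately show ?thesis
        by blast
    qed
    fix a b d assume abd: "a \<in> A" "b \<in> A" "d \<in> A" "d \<le> a + b"
    show "f d \<le> f a + f b"
    \<comment> \<open>Monotonicity settles the first case. Otherwise the decreasing quotients give
      \<open>f d * a < f a * d\<close> and \<open>f d * b < f b * d\<close>; these are added and
      combined with \<open>d \<le> a + b\<close>.\<close>
    proof (cases "d \<le> a \<or> d \<le> b")
      case True
      then have "f d \<le> f a \<or> f d \<le> f b"
        using mono abd by (metis order_le_less)
      then show ?thesis
        using f_nonneg[of a] f_nonneg[of b] by linarith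
    next
      case False
      then have "a \<in> A'" "b \<in> A'" "d \<in> A'"
        using abd A_cases[OF abd(1)] A_cases[OF abd(2)] A_cases[OF abd(3)] nonneg by force+
      then have "f d * a < f a * d" "f d * b < f b * d" "0 < a + b" "0 < f a + f b"
        using comp[of a d] comp[of b d] False f(2) by (auto simp: star_compatible_def A'_def add_pos_pos)
      then have "f d * (a + b) < (f a + f b) * d"
        by (simp add: algebra_simps)
      also have "\<dots> \<le> (f a + f b) * (a + b)"
        using abd(4) \<open>0 < f a + f b\<close> by simp
      finally show ?thesis
        using \<open>0 < a + b\<close> by simp
    qed
  qed
  \<comment> \<open>All values of \<open>f\<close> lie below \<open>r\<close>, so every ball of
    radius \<open>r\<close> is the whole rescaled space and any positive width will do. The skipped
    values are the \<open>R n\<close>, which \<open>T\<close> omits and which come arbitrarily close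
    to \<open>0\<close>.\<close>
  have "layering A (f ` A) (\<lambda>_. r) (\<lambda>_. 1)"
  proof
    show "f ` A \<subseteq> A"
    proof (rule image_subsetI)
      show "f a \<in> A" if "a \<in> A" for a
        using A_cases[OF that] f(1)[of a] z A(2) by (auto simp: T_def)
    qed
    show "t \<le> r \<or> r + 1 \<le> t" if "t \<in> f ` A" for t
      using that lt_r by force
    show "\<exists>b\<in>A. 0 < b \<and> b < a \<and> (\<forall>t\<in>f ` A. t \<le> r \<longrightarrow> t \<noteq> b)" if "0 < b'" "b' < a" for a b'
    proof -
      have "0 < a"
        using that by linarith
      then obtain n where "inverse (real (Suc n)) < a"
        using reals_Archimedean by blast
      then have "R n < a"
        using R(3)[of n] by linarith
      moreover have "t \<noteq> R n" if "t \<in> f ` A" for t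
        using that A_cases f(1) z R(2)[of n] by (fastforce simp: T_def)
      ultimately show ?thesis
        using R by blast
    qed
  qed (use A nonneg r in auto)
  then show ?thesis
    using resc by blast
qed

lemma exists_rescaling_layering:
  assumes "countable A" "0 \<in> A" "\<And>a. a \<in> A \<Longrightarrow> 0 \<le> a"
  shows "\<exists>f s \<delta>. rescaling A f \<and> layering A (f ` A) s \<delta>"
proof (cases "\<exists>r>0. \<forall>x y. 0 \<le> x \<longrightarrow> x < y \<longrightarrow> y \<le> r \<longrightarrow> (\<exists>t\<in>A. x < t \<and> t < y)")
  case True
  then show ?thesis
    using dense_near_zero_rescaling[OF assms] by blast
next
  case False
  then show ?thesis
    using gaps_near_zero_rescaling[OF assms(2,3)] by meson
qed

section \<open>Reducibility\<close>

text \<open>\<open>f\<close> can be any function: with countably many values, each fibre of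
  \<open>g\<close> being measurable is enough.\<close>

lemma borel_measurable_fun_countable_range:
  fixes g :: "'a \<Rightarrow> real" and f :: "real \<Rightarrow> real"
  assumes "g \<in> borel_measurable N" "\<And>x. x \<in> space N \<Longrightarrow> g x \<in> A" "countable A"
  shows "(\<lambda>x. f (g x)) \<in> borel_measurable N"
proof -
  have "{x \<in> space N. g x = a} \<in> sets N" for a
    using assms(1) by measurable
  then have "g \<in> N \<rightarrow>\<^sub>M count_space A"
    using assms(2) by (auto simp: measurable_count_space_eq_countable[OF assms(3)] vimage_def Int_def conj_commute)
  then show ?thesis
    by (rule measurable_compose) simp
qed

theorem theorem5p10:
  fixes U :: "'u metric" and A :: "real set"
  assumes "Urysohn_metric U"
    and "distance_set A"
    and "countable A"
  shows "borel_bireducible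
           (restrict_space (effros U) (spaces_within U A)) (isometric_subspaces U)
           (restrict_space (effros U) (spaces_exactly U A)) (isometric_subspaces U)"
proof -
  have PU: "Polish_metric U"
    using assms(1) by (simp add: Urysohn_metric_def)
  obtain Z :: "real metric" where "mspace Z \<noteq> {}" and Z: "A = dist_values Z"
    using assms(2) by (auto simp: distance_set_def Polish_metric_def)
  then have A0: "0 \<in> A" and nonneg: "\<And>a. a \<in> A \<Longrightarrow> 0 \<le> a"
    using zero_in_dist_values[of Z] dist_values_nonneg[of _ Z] by simp_all
  obtain f s \<delta> where resc: "rescaling A f" and lay: "layering A (f ` A) s \<delta>"
    using exists_rescaling_layering[OF assms(3) A0 nonneg] by blast
  interpret rescaling A f by (rule resc)
  interpret L: layering A "f ` A" s \<delta> by (rule lay)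
  let ?W = "restrict_space (effros U) (spaces_within U A)"
  let ?E = "restrict_space (effros U) (spaces_exactly U A)"
  have spW: "space ?W = spaces_within U A" and spE: "space ?E = spaces_exactly U A"
    by (auto simp: space_restrict_space spaces_within_def spaces_exactly_def)
  have sub: "spaces_exactly U A \<subseteq> spaces_within U A"
    by (auto simp: spaces_exactly_def spaces_within_def)
  obtain e where e: "\<And>X. X \<in> closed_nonempty U \<Longrightarrow> dense_seq (submetric U X) (e X)"
    and e_meas: "\<And>i j. (\<lambda>X. mdist U (e X i) (e X j)) \<in> borel_measurable (effros U)"
    using effros_dense_selectors[OF PU] by blast
  define c where "c = from_nat_into A"
  have c: "range c = A"
    unfolding c_def using A0 by (intro range_from_nat_into assms(3)) auto
  define \<Psi> where "\<Psi> X = rescaled f (submetric U X)" for X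
  define \<Phi> where "\<Phi> X = layered A s (\<Psi> X)" for X
  define e' where "e' X i = (e X (fst (prod_decode i)), c (snd (prod_decode i)))" for X i
  have W: "X \<in> closed_nonempty U" "dist_values (submetric U X) \<subseteq> A" if "X \<in> spaces_within U A" for X
    using that by (auto simp: spaces_within_def)
  have D\<Psi>: "dist_values (\<Psi> X) \<subseteq> f ` A" if "X \<in> spaces_within U A" for X
    unfolding \<Psi>_def by (rule dist_values_rescaled[OF W(2)[OF that]])
  have e\<Psi>: "dense_seq (\<Psi> X) (e X)" if "X \<in> spaces_within U A" for X
    unfolding \<Psi>_def by (rule dense_seq_rescaled[OF W(2)[OF that] e[OF W(1)[OF that]]])
  have e\<Phi>: "dense_seq (\<Phi> X) (e' X)" if "X \<in> spaces_within U A" for X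
    unfolding \<Phi>_def e'_def[abs_def] by (rule L.dense_seq_layered[OF D\<Psi>[OF that] e\<Psi>[OF that] c])
  have ne: "mspace (\<Psi> X) \<noteq> {}" if "X \<in> spaces_within U A" for X
    using dense_seq_in[OF e\<Psi>[OF that]] by blast
  have D\<Phi>: "dist_values (\<Phi> X) = A" if "X \<in> spaces_within U A" for X
    unfolding \<Phi>_def by (rule L.dist_values_layered[OF D\<Psi>[OF that] ne[OF that]])
  have P\<Phi>: "Polish_metric (\<Phi> X)" if X: "X \<in> spaces_within U A" for X
  proof -
    have "mcomplete_of (submetric U X)"
      using Polish_submetric[OF PU W(1)[OF X] e[OF W(1)[OF X]]] by (simp add: Polish_metric_def)
    then have "mcomplete_of (\<Phi> X)"
      unfolding \<Phi>_def \<Psi>_def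
      using L.mcomplete_layered[OF D\<Psi>[OF X]] mcomplete_rescaled[OF W(2)[OF X]] by (simp add: \<Psi>_def)
    moreover have "mspace (\<Phi> X) \<noteq> {}"
      using ne[OF X] A0 by (auto simp: \<Phi>_def)
    ultimately show ?thesis
      using separable_of_dense_seq[OF e\<Phi>[OF X]] by (simp add: Polish_metric_def)
  qed
  have \<Phi>_iff: "isometric (\<Phi> X) (\<Phi> Y) \<longleftrightarrow> isometric_subspaces U X Y"
    if "X \<in> spaces_within U A" "Y \<in> spaces_within U A" for X Y
    unfolding \<Phi>_def isometric_subspaces_def
    using L.isometric_layered[of "\<Psi> X" "\<Psi> Y"] L.isometric_of_layered[OF D\<Psi>[OF that(1)] D\<Psi>[OF that(2)]]
      isometry_rescaled_iff[OF W(2)[OF that(1)] W(2)[OF that(2)]]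
    by (auto simp: \<Psi>_def)
  have d_meas: "(\<lambda>X. mdist U (e X i) (e X j)) \<in> borel_measurable ?W" for i j
    by (rule measurable_restrict_space1[OF e_meas])
  have eU: "mdist U (e X i) (e X j) \<in> A" if "X \<in> space ?W" for X i j
  proof -
    have X: "X \<in> spaces_within U A"
      using that by (simp add: spW)
    show ?thesis
      using mdist_in_A[OF W(2)[OF X] dense_seq_in[OF e[OF W(1)[OF X]], of i]
          dense_seq_in[OF e[OF W(1)[OF X]], of j]] by simp
  qed
  have [measurable]: "(\<lambda>X. f (mdist U (e X i) (e X j))) \<in> borel_measurable ?W" for i j
    by (rule borel_measurable_fun_countable_range[OF d_meas eU assms(3)])
  have meas: "(\<lambda>X. mdist (\<Phi> X) (e' X i) (e' X j)) \<in> borel_measurable ?W" for i j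
  proof -
    define i1 i2 j1 j2 where "i1 = fst (prod_decode i)" and "i2 = c (snd (prod_decode i))"
      and "j1 = fst (prod_decode j)" and "j2 = c (snd (prod_decode j))"
    have i2: "i2 \<in> A"
      using c by (auto simp: i2_def)
    \<comment> \<open>The relation inside a layer is tested on the dense sequence
      \<open>e X\<close>, leaving countably many Borel conditions. In layer \<open>0\<close> both
      branches equal \<open>0\<close>, so that layer can be exempted from the test.\<close>
    have "mdist (\<Phi> X) (e' X i) (e' X j) = max (f (mdist U (e X i1) (e X j1)))
      (if i2 = j2 \<and> (i2 = 0 \<or> (\<forall>n. f (mdist U (e X i1) (e X n)) \<le> s i2 \<longleftrightarrow> f (mdist U (e X j1) (e X n)) \<le> s i2))
       then 0 else max i2 j2)" if "X \<in> space ?W" for X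
    proof -
      have X: "X \<in> spaces_within U A"
        using that spW by simp
      have m: "mdist (\<Psi> X) x y = f (mdist U x y)" for x y
        by (simp add: \<Psi>_def mdist_rescaled[OF W(2)[OF X]])
      have "same_layer_ball s (\<Psi> X) i2 (e X i1) (e X j1) \<longleftrightarrow>
          (\<forall>n. f (mdist U (e X i1) (e X n)) \<le> s i2 \<longleftrightarrow> f (mdist U (e X j1) (e X n)) \<le> s i2)" if "i2 > 0"
        using L.same_layer_ball_dense_iff[OF D\<Psi>[OF X] e\<Psi>[OF X] i2 that
            dense_seq_in[OF e\<Psi>[OF X]] dense_seq_in[OF e\<Psi>[OF X]], of i1 j1]
        by (simp add: m)
      moreover have "i2 = 0 \<or> i2 > 0"
        using nonneg[OF i2] by auto
      ultimately show ?thesis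
        by (auto simp: \<Phi>_def e'_def layer_dist_def m i1_def i2_def j1_def j2_def)
    qed
    moreover have "(\<lambda>X. max (f (mdist U (e X i1) (e X j1)))
      (if i2 = j2 \<and> (i2 = 0 \<or> (\<forall>n. f (mdist U (e X i1) (e X n)) \<le> s i2 \<longleftrightarrow> f (mdist U (e X j1) (e X n)) \<le> s i2))
       then 0 else max i2 j2)) \<in> borel_measurable ?W"
      by measurable
    ultimately show ?thesis
      by (subst measurable_cong) auto
  qed
  obtain g where g: "g \<in> ?W \<rightarrow>\<^sub>M effros U"
    and g_iso: "\<And>X. X \<in> space ?W \<Longrightarrow> isometric (\<Phi> X) (submetric U (g X))"
    by (rule Borel_realization[of U A ?W \<Phi> e'])
      (use assms P\<Phi> e\<Phi> D\<Phi> meas in \<open>auto simp: spW\<close>)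
  have "borel_reducible ?W (isometric_subspaces U) ?E (isometric_subspaces U)"
    unfolding borel_reducible_def
  proof (intro bexI[of _ g] ballI)
    have "g X \<in> spaces_exactly U A" if X: "X \<in> space ?W" for X
    proof -
      have "g X \<in> closed_nonempty U"
        using measurable_space[OF g X] by simp
      moreover have "dist_values (submetric U (g X)) = A"
        using g_iso[OF X] isometry_dist_values D\<Phi> X unfolding isometric_def spW by metis
      ultimately show ?thesis
        by (simp add: spaces_exactly_def)
    qed
    then show "g \<in> ?W \<rightarrow>\<^sub>M ?E"
      using g by (intro measurable_restrict_space2) auto
    fix X Y assume X: "X \<in> space ?W" and Y: "Y \<in> space ?W"
    have "isometric (submetric U (g X)) (submetric U (g Y)) \<longleftrightarrow> isometric (\<Phi> X) (\<Phi> Y)"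
      using g_iso[OF X] g_iso[OF Y] isometric_sym isometric_trans by metis
    then show "isometric_subspaces U X Y \<longleftrightarrow> isometric_subspaces U (g X) (g Y)"
      using \<Phi>_iff[of X Y] X Y by (simp add: spW isometric_subspaces_def)
  qed
  \<comment> \<open>In the other direction the inclusion of \<open>spaces_exactly U A\<close> into
    \<open>spaces_within U A\<close> is a reduction.\<close>
  moreover have "borel_reducible ?E (isometric_subspaces U) ?W (isometric_subspaces U)"
    unfolding borel_reducible_def
  proof (intro bexI[of _ "\<lambda>X. X"] ballI)
    show "(\<lambda>X. X) \<in> ?E \<rightarrow>\<^sub>M ?W"
      using sub spE by (intro measurable_restrict_space2 measurable_restrict_space1) auto
  qed simp
  ultimately show ?thesis
    by (simp add: borel_bireducible_def)
qed

end
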